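(* Let $\tau\in\{132,321,213\}$. For each $n\in\mathbb{N}$ let $\Pi_n$ be a random permutation in $\mathcal{S}_n(\tau)$ distributed according to $\mathbb{P}_n^{3,\tau}$, i.e. $\mathbb{P}(\Pi_n=\sigma)=3^{\mathrm{fp}(\sigma)}/Z_n(3,\tau)$ for $\sigma\in\mathcal{S}_n(\tau)$, where $Z_n(3,\tau)=\sum_{\sigma\in\mathcal{S}_n(\tau)}3^{\mathrm{fp}(\sigma)}$. Then as $n\to\infty$, $\mathrm{fp}(\Pi_n)/\sqrt{n}$ converges in distribution to a $\mathrm{Rayleigh}(3/\sqrt{2})$ random variable.
   Context: $\mathcal{S}_n$ denotes the set of permutations of $\{1,\dots,n\}$, written in one-line notation $\sigma=\sigma_1\cdots\sigma_n$. For $\sigma\in\mathcal{S}_n$, $\mathrm{fp}(\sigma)$ is the number of $i$ with $\sigma_i=i$. For $\tau\in\mathcal{S}_m$ with $2\le m\le n$, $\sigma$ contains the pattern $\tau$ if there are indices $1\le i_1<\cdots<i_m\le n$ such that for all $j,k$, $\sigma_{i_j}<\sigma_{i_k}$ iff $\tau_j<\tau_k$; otherwise $\sigma$ avoids $\tau$ (and if $m>n$ every $\sigma\in\mathcal{S}_n$ avoids $\tau$). $\mathcal{S}_n(\tau)$ is the set of $\sigma\in\mathcal{S}_n$ avoiding $\tau$. For $s>0$, a $\mathrm{Rayleigh}(s)$ random variable has density $\frac{x}{s^2}e^{-x^2/(2s^2)}$ for $x\ge0$ and $0$ for $x<0$. *)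

theory Defs
  imports "HOL-Probability.Probability"
begin

text \<open>Permutations of {1..n}: functions nat => nat permuting {1..n} (identity outside).
  Patterns tau are given in one-line notation as lists of values 1..m.\<close>

definition fixpoints :: "nat \<Rightarrow> (nat \<Rightarrow> nat) \<Rightarrow> nat" where
  "fixpoints n \<sigma> = card {i \<in> {1..n}. \<sigma> i = i}"

definition contains_pattern :: "nat \<Rightarrow> (nat \<Rightarrow> nat) \<Rightarrow> nat list \<Rightarrow> bool" where
  "contains_pattern n \<sigma> \<tau> \<longleftrightarrow>
     (\<exists>idx :: nat \<Rightarrow> nat.
        (\<forall>j < length \<tau>. idx j \<in> {1..n}) \<and>
        (\<forall>j k. j < k \<and> k < length \<tau> \<longrightarrow> idx j < idx k) \<and>
        (\<forall>j < length \<tau>. \<forall>k < length \<tau>. (\<sigma> (idx j) < \<sigma> (idx k) \<longleftrightarrow> \<tau> ! j < \<tau> ! k)))"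

definition avoiders :: "nat \<Rightarrow> nat list \<Rightarrow> (nat \<Rightarrow> nat) set" where
  "avoiders n \<tau> = {\<sigma>. \<sigma> permutes {1..n} \<and> \<not> contains_pattern n \<sigma> \<tau>}"

definition partition_fn :: "real \<Rightarrow> nat \<Rightarrow> nat list \<Rightarrow> real" where
  "partition_fn q n \<tau> = (\<Sum>\<sigma>\<in>avoiders n \<tau>. q ^ fixpoints n \<sigma>)"

definition weighted_perm_measure :: "real \<Rightarrow> nat \<Rightarrow> nat list \<Rightarrow> (nat \<Rightarrow> nat) measure" where
  "weighted_perm_measure q n \<tau> =
     density (count_space UNIV)
       (\<lambda>\<sigma>. ennreal (if \<sigma> \<in> avoiders n \<tau> then q ^ fixpoints n \<sigma> / partition_fn q n \<tau> else 0))"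

definition scaled_fp_law :: "real \<Rightarrow> nat \<Rightarrow> nat list \<Rightarrow> real measure" where
  "scaled_fp_law q n \<tau> =
     distr (weighted_perm_measure q n \<tau>) borel (\<lambda>\<sigma>. real (fixpoints n \<sigma>) / sqrt (real n))"

definition rayleigh_density :: "real \<Rightarrow> real \<Rightarrow> real" where
  "rayleigh_density s x = (if x \<ge> 0 then x / s\<^sup>2 * exp (- x\<^sup>2 / (2 * s\<^sup>2)) else 0)"

definition rayleigh :: "real \<Rightarrow> real measure" where
  "rayleigh s = density lborel (\<lambda>x. ennreal (rayleigh_density s x))"

end

theory Submission
  imports Defs "HOL-Library.Sublist" "HOL-Real_Asymp.Real_Asymp"
begin

text \<open>
  Weight a permutation by \<open>3 ^ fp = (\<Sum>S \<subseteq> Fix. 2 ^ card S)\<close>, i.e. mark each fixed point independently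
  with probability \<open>2/3\<close>. For all three patterns the generating function of avoiders with \<open>k\<close> marked
  fixed points is \<open>x ^ k * C(x) ^ (k + 1)\<close>, where \<open>C\<close> is the Catalan series, so their number is a
  ballot number \<open>(2n - k choose n) - (2n - k choose n + 1)\<close>. Multiplied by \<open>2 ^ k\<close> these telescope: the
  number \<open>K\<close> of marks satisfies
  \<open>P (K \<ge> m) = 2 ^ m * (2n + 1 - m choose n + 1) / (2n + 1 choose n + 1)\<close>, which tends to \<open>exp (- c\<^sup>2 / 4)\<close>
  for \<open>m \<sim> c * sqrt n\<close>. Given \<open>fp\<close>, \<open>K\<close> is binomial with parameters \<open>fp\<close> and \<open>2/3\<close>, so by Chebyshev's
  inequality \<open>fp\<close> is \<open>3/2 * K\<close> up to \<open>o(sqrt n)\<close>.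
\<close>

subsection \<open>Catalan and ballot numbers\<close>

text \<open>The weight 3 is critical. Marks then have weight 2, and the denominator of
  \<open>C / (1 - 2 * x * C)\<close> vanishes exactly at the branch point x = 1/4 of the Catalan
  series, where C = 2. Pole and square-root singularity meet, which is why fixed points are of order
  sqrt n. Below, the same coincidence appears as an instance of Pascal's rule, and consecutive tails
  of the number of marks have a rational ratio, so elementary product bounds replace singularity
  analysis and Stirling's formula. The combinatorial identity is proved for every mark weight
  \<open>t\<close>, because the law of the number of marks needs the single coefficients and not
  just the value at 2. No one decomposition serves all patterns: a 132-avoider is cut at its
  maximum, a 321-avoider at a marked fixed point, and 213 reduces to 132 by a symmetry. The Rayleigh
  parameter comes from \<open>c = 2 * x / 3\<close>: this turns c^2/4 into x^2/9, and 2 s^2 = 9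
  gives s = 3 / sqrt 2.\<close>

fun catalan :: "nat \<Rightarrow> real" where
  "catalan 0 = 1"
| "catalan (Suc n) = (\<Sum>i\<le>n. catalan i * catalan (n - i))"

text \<open>A common fingerprint. It is verified for the closed form \<open>ballot\<close>, for the
  coefficients of x^k C^(k+1), and for the numbers of 321-avoiders with an increasing suffix;
  uniqueness then identifies the three without Lagrange inversion or a bijection.\<close>

definition ballot_array :: "(nat \<Rightarrow> nat \<Rightarrow> real) \<Rightarrow> bool" where
  "ballot_array U \<longleftrightarrow>
     U 0 0 = 1 \<and> (\<forall>n j. n < j \<longrightarrow> U n j = 0) \<and>
     (\<forall>n. U (Suc n) 0 = U (Suc n) 1) \<and>
     (\<forall>n j. U (Suc n) (Suc j) = U (Suc n) (Suc (Suc j)) + U n j)"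

lemma ballot_arrayD:
  assumes "ballot_array U"
  shows "U 0 0 = 1" "n < j \<Longrightarrow> U n j = 0" "U (Suc n) 0 = U (Suc n) (Suc 0)"
    "U (Suc n) (Suc j) = U (Suc n) (Suc (Suc j)) + U n j"
  using assms unfolding ballot_array_def One_nat_def by blast+

text \<open>Each row is filled from right to left: entries beyond the diagonal vanish, every other
  entry follows from its right neighbour and the previous row, and column 0 copies column 1.\<close>

lemma ballot_array_unique:
  assumes U: "ballot_array U" and V: "ballot_array V"
  shows "U n j = V n j"
proof (induction n arbitrary: j)
  case 0
  show ?case
    using ballot_arrayD(1)[OF U] ballot_arrayD(1)[OF V] ballot_arrayD(2)[OF U, of 0 j]
      ballot_arrayD(2)[OF V, of 0 j] by (cases j) simp_all
next
  case (Suc n)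
  note IH = Suc
  have *: "U (Suc n) (Suc j) = V (Suc n) (Suc j)" for j
  proof (induction "Suc n - j" arbitrary: j)
    case 0
    then have "Suc n < Suc j" by simp
    then show ?case by (simp only: ballot_arrayD(2)[OF U] ballot_arrayD(2)[OF V])
  next
    case (Suc d)
    then have "U (Suc n) (Suc (Suc j)) = V (Suc n) (Suc (Suc j))"
      by auto
    then show ?case
      using IH[of j] ballot_arrayD(4)[OF U, of n j] ballot_arrayD(4)[OF V, of n j] by linarith
  qed
  show ?case
  proof (cases j)
    case 0
    then show ?thesis by (simp only: ballot_arrayD(3)[OF U] ballot_arrayD(3)[OF V] *)
  next
    case (Suc k)
    then show ?thesis using * by simp
  qed
qed

text \<open>The guard is decisive at \<open>n = 0\<close>, where truncated subtraction would give
  \<open>0 choose 0 = 1\<close> for every \<open>k\<close>.\<close>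

definition ballot :: "nat \<Rightarrow> nat \<Rightarrow> real" where
  "ballot n k = (if k \<le> n then real (2 * n - k choose n) - real (2 * n - k choose Suc n) else 0)"

lemma ballot_array_ballot: "ballot_array ballot"
  unfolding ballot_array_def
proof (intro conjI allI impI)
  show "ballot 0 0 = 1" by (simp add: ballot_def)
  show "ballot n j = 0" if "n < j" for n j using that by (simp add: ballot_def)
  show "ballot (Suc n) 0 = ballot (Suc n) 1" for n
  proof -
    have "Suc (2 * n) choose n = Suc (2 * n) choose (Suc n)"
      using binomial_symmetric[of n "Suc (2*n)"] by (simp add: Suc_diff_le)
    then show ?thesis by (simp add: ballot_def)
  qed
  show "ballot (Suc n) (Suc j) = ballot (Suc n) (Suc (Suc j)) + ballot n j" for n j
  proof -
    consider "j < n" | "j = n" | "n < j" by linarith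
    then show ?thesis
    proof cases
      case 1
      then obtain d where d: "n = Suc (j + d)" using less_imp_Suc_add by blast
      have "2 * Suc n - Suc j = Suc (2 * n - j)" "2 * Suc n - Suc (Suc j) = 2 * n - j"
        using 1 by auto
      then show ?thesis using 1 by (simp add: ballot_def)
    qed (auto simp: ballot_def)
  qed
qed

definition catalan_fps :: "real fps" where
  "catalan_fps = Abs_fps catalan"

lemma catalan_fps_eq: "catalan_fps = 1 + fps_X * catalan_fps\<^sup>2"
proof (rule fps_ext)
  fix n
  show "fps_nth catalan_fps n = fps_nth (1 + fps_X * catalan_fps\<^sup>2) n"
  proof (cases n)
    case (Suc m)
    then show ?thesis
      by (simp add: catalan_fps_def power2_eq_square fps_mult_nth[of "Abs_fps catalan"] atMost_atLeast0)
  qed (simp add: catalan_fps_def)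
qed

text \<open>The recurrence is C = 1 + x C^2 multiplied by x^(j+1) C^(j+1); the boundary column is
  that equation itself, read in positive degrees.\<close>

lemma ballot_array_catalan_fps:
  "ballot_array (\<lambda>n k. fps_nth (fps_X ^ k * catalan_fps ^ Suc k) n)"
  unfolding ballot_array_def
proof (intro conjI allI impI)
  show "fps_nth (fps_X ^ 0 * catalan_fps ^ Suc 0) 0 = 1"
    by (simp add: catalan_fps_def)
  show "fps_nth (fps_X ^ j * catalan_fps ^ Suc j) n = 0" if "n < j" for n j
    using that by (simp only: fps_X_power_mult_nth) auto
  show "fps_nth (fps_X ^ 0 * catalan_fps ^ Suc 0) (Suc n) = fps_nth (fps_X ^ 1 * catalan_fps ^ Suc 1) (Suc n)" for n
  proof -
    have "fps_X ^ 1 * catalan_fps ^ Suc 1 = catalan_fps - 1"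
      by (subst (2) catalan_fps_eq) (simp add: power2_eq_square)
    then show ?thesis by simp
  qed
  show "fps_nth (fps_X ^ Suc j * catalan_fps ^ Suc (Suc j)) (Suc n) =
     fps_nth (fps_X ^ Suc (Suc j) * catalan_fps ^ Suc (Suc (Suc j))) (Suc n) + fps_nth (fps_X ^ j * catalan_fps ^ Suc j) n" for n j
  proof -
    have "fps_X ^ Suc j * catalan_fps ^ Suc (Suc j) =
          fps_X ^ Suc j * catalan_fps ^ Suc j * (1 + fps_X * catalan_fps\<^sup>2)"
      unfolding catalan_fps_eq[symmetric] by (simp only: power_Suc mult_ac)
    also have "\<dots> = fps_X ^ Suc (Suc j) * catalan_fps ^ Suc (Suc (Suc j)) + fps_X * (fps_X ^ j * catalan_fps ^ Suc j)"
      by (simp only: power_Suc power2_eq_square distrib_left mult_1_left mult_1_right mult_ac add.commute)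
    finally show ?thesis by (simp only: fps_add_nth fps_X_mult_nth) simp
  qed
qed

lemma ballot_eq_fps_nth: "ballot n k = fps_nth (fps_X ^ k * catalan_fps ^ Suc k) n"
  by (rule ballot_array_unique[OF ballot_array_ballot ballot_array_catalan_fps])

lemma ballot_0: "ballot n 0 = catalan n"
  by (simp add: ballot_eq_fps_nth catalan_fps_def)

text \<open>Splits one factor x C off x^(k+1) C^(k+2).\<close>

lemma ballot_Suc: "ballot (Suc n) (Suc k) = (\<Sum>m\<le>n. catalan m * ballot (n - m) k)"
proof -
  have "fps_X ^ Suc k * catalan_fps ^ Suc (Suc k) =
        fps_X * (catalan_fps * (fps_X ^ k * catalan_fps ^ Suc k))"
    by (simp add: algebra_simps)
  then show ?thesis
    unfolding ballot_eq_fps_nth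
    by (simp only: fps_X_mult_nth)
       (simp add: fps_mult_nth[of "Abs_fps catalan"] catalan_fps_def atMost_atLeast0)
qed

text \<open>The coefficients of \<open>C / (1 - t * x * C)\<close>, with \<open>C\<close> the Catalan series.\<close>

fun marked :: "real \<Rightarrow> nat \<Rightarrow> real" where
  "marked t 0 = 1"
| "marked t (Suc n) = catalan (Suc n) + t * (\<Sum>m\<le>n. catalan m * marked t (n - m))"

text \<open>The geometric series of C / (1 - t x C), coefficient by coefficient: the recursion of
  \<open>marked\<close> peels off one factor t x C.\<close>

lemma marked_eq_ballot: "marked t n = (\<Sum>k\<le>n. ballot n k * t ^ k)"
proof (induction n rule: less_induct)
  case (less n)
  show ?case
  proof (cases n)
    case 0
    then show ?thesis by (simp add: ballot_def)
  next
    case (Suc l)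
    have "marked t n = catalan n + t * (\<Sum>m\<le>l. catalan m * (\<Sum>k\<le>l - m. ballot (l - m) k * t ^ k))"
      using less Suc by simp
    also have "(\<Sum>m\<le>l. catalan m * (\<Sum>k\<le>l - m. ballot (l - m) k * t ^ k)) =
               (\<Sum>m\<le>l. catalan m * (\<Sum>k\<le>l. ballot (l - m) k * t ^ k))"
      by (intro sum.cong refl arg_cong2[of _ _ _ _ "(*)"] sum.mono_neutral_left) (auto simp: ballot_def)
    also have "\<dots> = (\<Sum>k\<le>l. \<Sum>m\<le>l. catalan m * ballot (l - m) k * t ^ k)"
      unfolding sum_distrib_left by (subst sum.swap) (simp add: mult.assoc)
    also have "\<dots> = (\<Sum>k\<le>l. ballot (Suc l) (Suc k) * t ^ k)"
      unfolding ballot_Suc sum_distrib_right ..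
    finally show ?thesis
      unfolding Suc sum.atMost_Suc_shift
      by (simp add: ballot_0 sum_distrib_left mult_ac)
  qed
qed

subsection \<open>Permutations in one-line notation avoiding 132\<close>

lemma subseq_triple_Cons:
  "subseq [a, b] (x # xs) \<longleftrightarrow> a = x \<and> b \<in> set xs \<or> subseq [a, b] xs"
  "subseq [a, b, c] (x # xs) \<longleftrightarrow> a = x \<and> subseq [b, c] xs \<or> subseq [a, b, c] xs"
  by (auto simp: subseq_singleton_left dest: subseq_Cons')

lemma subseq_triple_append:
  "subseq [a, b] (xs @ ys) \<longleftrightarrow> subseq [a, b] xs \<or> a \<in> set xs \<and> b \<in> set ys \<or> subseq [a, b] ys"
  "subseq [a, b, c] (xs @ ys) \<longleftrightarrow> subseq [a, b, c] xs \<or> subseq [a, b] xs \<and> c \<in> set ys \<or>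
     a \<in> set xs \<and> subseq [b, c] ys \<or> subseq [a, b, c] ys"
proof -
  show 2: "subseq [a, b] (xs @ ys) \<longleftrightarrow> subseq [a, b] xs \<or> a \<in> set xs \<and> b \<in> set ys \<or> subseq [a, b] ys"
    for a b :: 'a and xs ys
  proof (induction xs)
    case (Cons x xs)
    then show ?case unfolding append_Cons subseq_triple_Cons by auto
  qed simp
  show "subseq [a, b, c] (xs @ ys) \<longleftrightarrow> subseq [a, b, c] xs \<or> subseq [a, b] xs \<and> c \<in> set ys \<or>
     a \<in> set xs \<and> subseq [b, c] ys \<or> subseq [a, b, c] ys"
  proof (induction xs)
    case (Cons x xs)
    then show ?case unfolding append_Cons subseq_triple_Cons 2 by auto
  qed simp
qed

lemma subseq_map_iff: "subseq ys (map f xs) \<longleftrightarrow> (\<exists>zs. ys = map f zs \<and> subseq zs xs)"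
  by (auto simp: subseq_conv_nths nths_map)

lemma subseq_mem: "subseq [a, b] xs \<Longrightarrow> a \<in> set xs \<and> b \<in> set xs"
  "subseq [a, b, c] xs \<Longrightarrow> a \<in> set xs \<and> b \<in> set xs \<and> c \<in> set xs"
proof -
  show 2: "subseq [a, b] xs \<Longrightarrow> a \<in> set xs \<and> b \<in> set xs" for a b and xs :: "'a list"
    by (induction xs) (auto simp: subseq_triple_Cons simp del: subseq_Cons2_iff)
  show "subseq [a, b, c] xs \<Longrightarrow> a \<in> set xs \<and> b \<in> set xs \<and> c \<in> set xs"
    by (induction xs) (auto simp: subseq_triple_Cons dest: 2 simp del: subseq_Cons2_iff)
qed

text \<open>Entries are integers so that blocks of values can be shifted and complemented without
  truncation.\<close>

definition perm_lists :: "nat \<Rightarrow> int list set" where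
  "perm_lists n = {xs. distinct xs \<and> set xs = {1..int n}}"

lemma length_perm_lists: "xs \<in> perm_lists n \<Longrightarrow> length xs = n"
  using distinct_card[of xs] by (simp add: perm_lists_def)

lemma finite_perm_lists [simp]: "finite (perm_lists n)"
proof (rule finite_subset)
  show "perm_lists n \<subseteq> {xs. set xs \<subseteq> {1..int n} \<and> length xs = n}"
    using length_perm_lists[of _ n] unfolding perm_lists_def by blast
qed (rule finite_lists_length_eq, simp)

text \<open>Start 1 gives the fixed points. Other starts, possibly negative, arise because the
  pieces of a cut list see shifted diagonals.\<close>

fun diag_hits :: "int \<Rightarrow> int list \<Rightarrow> nat" where
  "diag_hits s [] = 0"
| "diag_hits s (x # xs) = of_bool (x = s) + diag_hits (s + 1) xs"

lemma diag_hits_append: "diag_hits s (xs @ ys) = diag_hits s xs + diag_hits (s + int (length xs)) ys"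
  by (induction xs arbitrary: s) (simp_all add: add_ac)

lemma diag_hits_map_add: "diag_hits s (map (\<lambda>x. x + c) xs) = diag_hits (s - c) xs"
  by (induction xs arbitrary: s) (auto simp: algebra_simps)

lemma diag_hits_rev_map_diff:
  "diag_hits s (rev (map (\<lambda>x. c - x) xs)) = diag_hits (c - s - int (length xs) + 1) xs"
  by (induction xs) (auto simp: diag_hits_append algebra_simps)

lemma down_closed_eq_Icc:
  fixes Y :: "int set"
  assumes "finite Y" "\<And>y. y \<in> Y \<Longrightarrow> 1 \<le> y" "\<And>y z. y \<in> Y \<Longrightarrow> 1 \<le> z \<Longrightarrow> z \<le> y \<Longrightarrow> z \<in> Y"
  shows "Y = {1..int (card Y)}"
proof (cases "Y = {}")
  case False
  define M where "M = Max Y"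
  have M: "M \<in> Y" using False assms(1) by (simp add: M_def)
  have Y: "Y = {1..M}"
  proof (intro equalityI subsetI)
    fix z assume "z \<in> {1..M}"
    then show "z \<in> Y" using assms(3)[OF M] by auto
  qed (use assms(1,2) in \<open>auto simp: M_def\<close>)
  have "1 \<le> M" using M assms(2) by blast
  then have "int (card Y) = M" unfolding Y by simp
  then show ?thesis using Y by metis
qed simp

lemma split_Icc_above:
  assumes un: "X \<union> Y = {1..int N}" and sep: "\<And>x y. x \<in> X \<Longrightarrow> y \<in> Y \<Longrightarrow> y < x" and N: "card X + card Y = N"
  shows "Y = {1..int (card Y)}" "X = {int (card Y) + 1..int (card Y) + int (card X)}"
proof -
  have fin: "finite Y" by (rule finite_subset[of _ "{1..int N}"]) (use un in auto)
  show Y: "Y = {1..int (card Y)}"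
  proof (rule down_closed_eq_Icc[OF fin])
    fix y z assume y: "y \<in> Y" and z: "1 \<le> z" "z \<le> y"
    have "y \<in> {1..int N}" using un y by blast
    then have "z \<in> X \<union> Y" using z unfolding un by auto
    then show "z \<in> Y" using sep y z by force
  qed (use un in force)
  have "X \<inter> Y = {}" using sep by force
  then have "X = {1..int N} - Y" using un by blast
  also have "\<dots> = {1..int N} - {1..int (card Y)}" using Y by (rule arg_cong)
  also have "\<dots> = {int (card Y) + 1..int (card Y) + int (card X)}" using N by auto
  finally show "X = {int (card Y) + 1..int (card Y) + int (card X)}" .
qed

definition avoids_132 :: "int list \<Rightarrow> bool" where
  "avoids_132 xs \<longleftrightarrow> (\<forall>a b c. subseq [a, b, c] xs \<longrightarrow> \<not> (a < c \<and> c < b))"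

lemma avoids_132_map_add: "avoids_132 (map (\<lambda>x. x + c) xs) \<longleftrightarrow> avoids_132 xs"
proof -
  have "(\<exists>a' b' c'. subseq [a', b', c'] (map (\<lambda>x. x + c) xs) \<and> a' < c' \<and> c' < b') \<longleftrightarrow>
        (\<exists>a b d. subseq [a, b, d] xs \<and> a < d \<and> d < b)"
    unfolding subseq_map_iff by (fastforce simp: Cons_eq_map_conv map_eq_Cons_conv)
  then show ?thesis unfolding avoids_132_def by blast
qed

text \<open>If \<open>x\<close> before the maximum \<open>z\<close> were below \<open>y\<close>
  after it, then \<open>x\<close>, \<open>z\<close>, \<open>y\<close> would form a 132. Conversely,
  once the front lies above the back, a 132 cannot straddle the cut.\<close>

lemma avoids_132_split_max:
  assumes "\<And>x. x \<in> set xs \<Longrightarrow> x < z" "\<And>y. y \<in> set ys \<Longrightarrow> y < z" "set xs \<inter> set ys = {}"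
  shows "avoids_132 (xs @ z # ys) \<longleftrightarrow>
    avoids_132 xs \<and> avoids_132 ys \<and> (\<forall>x\<in>set xs. \<forall>y\<in>set ys. y < x)"
proof
  assume av: "avoids_132 (xs @ z # ys)"
  have "y < x" if "x \<in> set xs" "y \<in> set ys" for x y
  proof (rule ccontr)
    assume "\<not> y < x"
    then have "x < y" using that assms(3) by (metis disjoint_iff linorder_neqE)
    moreover have "subseq [x, z, y] (xs @ z # ys)"
      using that by (auto simp: subseq_triple_append subseq_singleton_left)
    ultimately show False using av assms(2) that unfolding avoids_132_def by blast
  qed
  then show "avoids_132 xs \<and> avoids_132 ys \<and> (\<forall>x\<in>set xs. \<forall>y\<in>set ys. y < x)"
    using av by (auto simp: avoids_132_def subseq_triple_append subseq_triple_Cons simp del: subseq_Cons2_iff)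
next
  assume r: "avoids_132 xs \<and> avoids_132 ys \<and> (\<forall>x\<in>set xs. \<forall>y\<in>set ys. y < x)"
  show "avoids_132 (xs @ z # ys)"
    unfolding avoids_132_def
  proof (intro allI impI)
    fix a b c assume "subseq [a, b, c] (xs @ z # ys)"
    then consider "subseq [a, b, c] xs" | "subseq [a, b] xs" "c = z" | "subseq [a, b] xs" "c \<in> set ys"
      | "a \<in> set xs" "c \<in> set ys" | "a = z" "b \<in> set ys" | "subseq [a, b, c] ys"
      by (auto simp: subseq_triple_append subseq_triple_Cons dest: subseq_mem simp del: subseq_Cons2_iff)
    then show "\<not> (a < c \<and> c < b)"
    proof cases
      case 1 then show ?thesis using r unfolding avoids_132_def by blast
    next
      case 2 then show ?thesis using assms(1)[of b] subseq_mem(1) by fastforce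
    next
      case 3 then show ?thesis using r subseq_mem(1) by fastforce
    next
      case 4 then show ?thesis using r by fastforce
    next
      case 5 then show ?thesis using assms(2)[of b] by fastforce
    next
      case 6 then show ?thesis using r unfolding avoids_132_def by blast
    qed
  qed
qed

definition av132 :: "nat \<Rightarrow> int list set" where
  "av132 n = {xs \<in> perm_lists n. avoids_132 xs}"

lemma finite_av132 [simp]: "finite (av132 n)"
  by (simp add: av132_def)

text \<open>The Catalan decomposition at the maximum. The part behind it has \<open>m\<close>
  entries, all below those in front, hence the values up to \<open>m\<close>; the front is a
  132-avoider raised by \<open>m\<close>. The triple is recovered because the maximum occurs once
  and \<open>m\<close> is the length of the back.\<close>

lemma bij_betw_av132_Suc:
  "bij_betw (\<lambda>(m, xs, ys). map (\<lambda>x. x + int m) xs @ int (Suc N) # ys)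
     (SIGMA m:{..N}. av132 (N - m) \<times> av132 m) (av132 (Suc N))"
  (is "bij_betw ?f ?S _")
proof (rule bij_betwI')
  show "?f p = ?f q \<longleftrightarrow> p = q" if pq: "p \<in> ?S" "q \<in> ?S" for p q
  proof
    obtain m xs ys k us vs where p: "p = (m, xs, ys)" and q: "q = (k, us, vs)"
      by (cases p, cases q) auto
    have notin: "int (Suc N) \<notin> set (map (\<lambda>x. x + int m) xs)" "int (Suc N) \<notin> set ys"
      "m = length ys" "k = length vs"
      using pq unfolding p q by (auto simp: av132_def length_perm_lists) (auto simp: perm_lists_def)
    assume "?f p = ?f q"
    then have "map (\<lambda>x. x + int m) xs = map (\<lambda>x. x + int k) us \<and> ys = vs"
      unfolding p q using notin(1,2) by (simp add: append_Cons_eq_iff)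
    then show "p = q" using notin(3,4) unfolding p q
      by (auto dest!: map_inj_on intro!: inj_onI)
  qed simp
next
  show "?f p \<in> av132 (Suc N)" if p: "p \<in> ?S" for p
  proof -
    obtain m xs ys where p': "p = (m, xs, ys)" by (cases p) auto
    have m: "m \<le> N" and xs: "distinct xs" "set xs = {1..int (N - m)}" "avoids_132 xs"
      and ys: "distinct ys" "set ys = {1..int m}" "avoids_132 ys"
      using p unfolding p' by (auto simp: av132_def perm_lists_def)
    have img: "(\<lambda>x. x + int m) ` {1..int (N - m)} = {int m + 1..int N}"
      using m by (auto simp: image_add_atLeastAtMost' of_nat_diff)
    have "avoids_132 (?f p)"
      unfolding p' prod.case
      by (subst avoids_132_split_max) (use xs ys m img in \<open>auto simp: avoids_132_map_add\<close>)
    moreover have "?f p \<in> perm_lists (Suc N)"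
      using xs ys m img unfolding p' by (auto simp: perm_lists_def distinct_map inj_on_def)
    ultimately show ?thesis by (simp add: av132_def)
  qed
next
  fix zs assume zs: "zs \<in> av132 (Suc N)"
  then have "int (Suc N) \<in> set zs" by (auto simp: av132_def perm_lists_def)
  then obtain xs ys where split: "zs = xs @ int (Suc N) # ys" by (auto dest: split_list)
  have d: "distinct xs" "distinct ys" "set xs \<inter> set ys = {}" "int (Suc N) \<notin> set xs \<union> set ys"
    and "insert (int (Suc N)) (set xs \<union> set ys) = {1..int (Suc N)}"
    using zs unfolding split av132_def perm_lists_def by auto
  then have un: "set xs \<union> set ys = {1..int N}" by (auto simp: set_eq_iff) (smt (verit))+
  have len: "length xs + length ys = N"
    using length_perm_lists[of zs "Suc N"] zs split by (simp add: av132_def)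
  have xs_lt: "x < int (Suc N)" if "x \<in> set xs \<union> set ys" for x
    using that un by auto
  have av: "avoids_132 xs" "avoids_132 ys" and sep: "\<And>x y. x \<in> set xs \<Longrightarrow> y \<in> set ys \<Longrightarrow> y < x"
    using zs avoids_132_split_max[of xs "int (Suc N)" ys] xs_lt d(3) unfolding split av132_def by auto
  define m where "m = length ys"
  have sets: "set ys = {1..int m}" "set xs = {int m + 1..int m + int (length xs)}"
    using split_Icc_above[OF un sep] len
    unfolding distinct_card[OF d(1)] distinct_card[OF d(2)] m_def by blast+
  define us where "us = map (\<lambda>x. x - int m) xs"
  have xs: "xs = map (\<lambda>x. x + int m) us" by (simp add: us_def o_def)
  have "us \<in> av132 (N - m)"
  proof -
    have "set us = {1..int (length xs)}"
      unfolding us_def set_map sets(2)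
      by (rule set_eqI) (auto simp: image_iff intro!: bexI[of _ "_ + int m"])
    moreover have "distinct us" using d(1) by (simp add: us_def distinct_map inj_on_def)
    ultimately show ?thesis using av(1) len unfolding xs
      by (auto simp: av132_def perm_lists_def avoids_132_map_add m_def)
  qed
  moreover have "ys \<in> av132 m" using sets av d by (simp add: av132_def perm_lists_def)
  ultimately have "(m, us, ys) \<in> ?S" using len by (auto simp: m_def)
  moreover have "zs = ?f (m, us, ys)" unfolding split xs by simp
  ultimately show "\<exists>p\<in>?S. zs = ?f p" by blast
qed

section \<open>Shifted diagonals of 132-avoiders\<close>

text \<open>Groups terms by \<open>s = m + p + 1\<close>: in a convolution of \<open>catalan\<close>
  with \<open>marked_tail\<close>, this is what fixes the argument \<open>N - s\<close> of
  \<open>marked\<close>.\<close>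

lemma sum_triangle_shift:
  fixes f :: "nat \<Rightarrow> nat \<Rightarrow> real"
  shows "(\<Sum>m\<le>N. \<Sum>p<N - m. f m p) = (\<Sum>s\<le>N. \<Sum>m<s. f m (s - 1 - m))"
  unfolding sum.Sigma[OF finite_atMost ballI[OF finite_lessThan]]
  by (rule sum.reindex_bij_witness[of _ "\<lambda>(s, m). (m, s - 1 - m)" "\<lambda>(m, p). (m + p + 1, m)"]) auto

lemma catalan_Suc_lessThan: "0 < s \<Longrightarrow> (\<Sum>m<s. catalan m * catalan (s - Suc m)) = catalan s"
  by (cases s) (auto simp: lessThan_Suc_atMost)

text \<open>Splitting a 132-avoider at its maximum shifts the diagonal differently on the two sides, so the
  induction has to cover all shifted diagonals \<open>i \<mapsto> i + r\<close>. The formula comes from nested tunnels in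
  Dyck paths: the outermost marked tunnel has offset \<open>r\<close>, which forces at least \<open>\<bar>r\<bar>\<close> steps outside it,
  and the tunnels inside are centred.\<close>

definition marked_tail :: "real \<Rightarrow> nat \<Rightarrow> int \<Rightarrow> real" where
  "marked_tail t n r = (\<Sum>s<n. of_bool (\<bar>r\<bar> \<le> int s) * catalan s * marked t (n - 1 - s))"

lemma marked_eq_tail: "marked t n = catalan n + t * marked_tail t n 0"
  by (cases n) (simp_all add: marked_tail_def lessThan_Suc_atMost)

lemma marked_tail_eq_0: "int n \<le> \<bar>r\<bar> \<Longrightarrow> marked_tail t n r = 0"
  by (auto simp: marked_tail_def intro!: sum.neutral)

text \<open>The three sums account for diagonal hits in front of the maximum, behind it, and at it.
  Comparing the factors of \<open>marked t (N - s)\<close> reduces the identity to the Catalan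
  recursion for \<open>catalan s\<close>.\<close>

lemma marked_tail_convolution:
  "(\<Sum>m\<le>N. catalan m * marked_tail t (N - m) (r - int m)) +
   (\<Sum>m\<le>N. catalan (N - m) * marked_tail t m (r + int N + 1 - int m)) +
   (\<Sum>m\<le>N. of_bool (int m = r) * catalan m * marked t (N - m)) = marked_tail t (Suc N) r"
proof -
  have 1: "(\<Sum>m\<le>N. catalan m * marked_tail t (N - m) (g m)) =
    (\<Sum>s\<le>N. marked t (N - s) * (\<Sum>m<s. of_bool (\<bar>g m\<bar> \<le> int (s - 1 - m)) * (catalan m * catalan (s - 1 - m))))"
    for g
    unfolding marked_tail_def sum_distrib_left sum_triangle_shift
    by (intro sum.cong refl) auto
  have "(\<Sum>m\<le>N. catalan (N - m) * marked_tail t m (r + int N + 1 - int m)) =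
        (\<Sum>m\<le>N. catalan m * marked_tail t (N - m) (r + 1 + int m))"
    by (rule sum.reindex_bij_witness[of _ "\<lambda>m. N - m" "\<lambda>m. N - m"]) (auto simp: of_nat_diff algebra_simps)
  also have "\<dots> = (\<Sum>s\<le>N. marked t (N - s) *
      (\<Sum>m<s. of_bool (\<bar>r + 1 + int m\<bar> \<le> int (s - 1 - m)) * (catalan m * catalan (s - 1 - m))))"
    by (rule 1)
  \<comment> \<open>Replacing \<open>m\<close> by \<open>s - 1 - m\<close> leaves the symmetric
    Catalan product alone and gives the indicator the form that complements the one in the first
    sum.\<close>
  also have "\<dots> = (\<Sum>s\<le>N. marked t (N - s) *
      (\<Sum>m<s. of_bool (\<bar>r + int (s - m)\<bar> \<le> int m) * (catalan m * catalan (s - 1 - m))))"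
  proof (rule sum.cong[OF refl], rule arg_cong2[where f = "(*)", OF refl])
    fix s
    show "(\<Sum>m<s. of_bool (\<bar>r + 1 + int m\<bar> \<le> int (s - 1 - m)) * (catalan m * catalan (s - 1 - m))) =
      (\<Sum>m<s. of_bool (\<bar>r + int (s - m)\<bar> \<le> int m) * (catalan m * catalan (s - 1 - m)))"
    proof (rule sum.reindex_bij_witness[of _ "\<lambda>m. s - 1 - m" "\<lambda>m. s - 1 - m"])
      fix m assume "m \<in> {..<s}"
      then have "s - (s - 1 - m) = m + 1" "s - 1 - (s - 1 - m) = m" by auto
      then show "of_bool (\<bar>r + int (s - (s - 1 - m))\<bar> \<le> int (s - 1 - m)) *
          (catalan (s - 1 - m) * catalan (s - 1 - (s - 1 - m))) =
        of_bool (\<bar>r + 1 + int m\<bar> \<le> int (s - 1 - m)) * (catalan m * catalan (s - 1 - m))"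
        by (simp add: add_ac mult_ac)
    qed auto
  qed
  finally have 2: "(\<Sum>m\<le>N. catalan (N - m) * marked_tail t m (r + int N + 1 - int m)) = \<dots>" .
  have 3: "(\<Sum>m<s. of_bool (\<bar>r - int m\<bar> \<le> int (s - 1 - m)) * (catalan m * catalan (s - 1 - m))) +
      (\<Sum>m<s. of_bool (\<bar>r + int (s - m)\<bar> \<le> int m) * (catalan m * catalan (s - 1 - m))) +
      of_bool (int s = r) * catalan s = of_bool (\<bar>r\<bar> \<le> int s) * catalan s" for s
  proof -
    \<comment> \<open>As conditions on \<open>r\<close> these are
      \<open>2 * m - s + 1 \<le> r \<le> s - 1\<close> and
      \<open>- s \<le> r \<le> 2 * m - s\<close>: adjacent intervals that together fill
      \<open>- s..s - 1\<close>. The remaining value \<open>r = s\<close> is supplied by the third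
      sum.\<close>
    have "of_bool (\<bar>r - int m\<bar> \<le> int (s - 1 - m)) + of_bool (\<bar>r + int (s - m)\<bar> \<le> int m) =
        (of_bool (\<bar>r\<bar> \<le> int s \<and> int s \<noteq> r) :: real)" if "m < s" for m
      using that by (auto simp: of_bool_def of_nat_diff)
    then have "(\<Sum>m<s. of_bool (\<bar>r - int m\<bar> \<le> int (s - 1 - m)) * (catalan m * catalan (s - 1 - m))) +
      (\<Sum>m<s. of_bool (\<bar>r + int (s - m)\<bar> \<le> int m) * (catalan m * catalan (s - 1 - m))) =
      (\<Sum>m<s. of_bool (\<bar>r\<bar> \<le> int s \<and> int s \<noteq> r) * (catalan m * catalan (s - 1 - m)))"
      unfolding sum.distrib[symmetric] distrib_right[symmetric] by (intro sum.cong) auto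
    also have "\<dots> = of_bool (\<bar>r\<bar> \<le> int s \<and> int s \<noteq> r) * catalan s"
      unfolding sum_distrib_left[symmetric]
      by (cases "s = 0") (auto simp: catalan_Suc_lessThan)
    finally show ?thesis by (auto simp: of_bool_def)
  qed
  have "marked_tail t (Suc N) r = (\<Sum>s\<le>N. marked t (N - s) * (of_bool (\<bar>r\<bar> \<le> int s) * catalan s))"
    by (simp add: marked_tail_def lessThan_Suc_atMost mult_ac)
  also have "\<dots> = (\<Sum>m\<le>N. catalan m * marked_tail t (N - m) (r - int m)) +
   (\<Sum>m\<le>N. catalan (N - m) * marked_tail t m (r + int N + 1 - int m)) +
   (\<Sum>m\<le>N. marked t (N - m) * (of_bool (int m = r) * catalan m))"
    unfolding 1 2 3[symmetric] distrib_left sum.distrib ..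
  finally show ?thesis by (simp add: mult_ac)
qed

text \<open>Cut at the maximum: the front sees offset \<open>r - m\<close>, the back sees
  \<open>r + N + 1 - m\<close>, and the maximum itself is hit iff \<open>m = r\<close>.\<close>

lemma sum_av132_diag:
  "(\<Sum>xs\<in>av132 n. (1 + t) ^ diag_hits (1 + r) xs) = catalan n + t * marked_tail t n r"
proof (induction n arbitrary: r rule: less_induct)
  case (less n)
  show ?case
  proof (cases n)
    case 0
    have "av132 0 = {[]}" by (auto simp: av132_def perm_lists_def avoids_132_def)
    then show ?thesis using 0 by (simp add: marked_tail_def)
  next
    case (Suc N)
    let ?A = "\<lambda>m. marked_tail t (N - m) (r - int m)"
    let ?B = "\<lambda>m. marked_tail t m (r + int N + 1 - int m)"
    have hits: "(1 + t) ^ diag_hits (1 + r) (map (\<lambda>x. x + int m) xs @ int (Suc N) # ys) =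
        (1 + t) ^ diag_hits (1 + (r - int m)) xs * (1 + t) ^ of_bool (int m = r) *
        (1 + t) ^ diag_hits (1 + (r + int N + 1 - int m)) ys"
      if "m \<le> N" "xs \<in> av132 (N - m)" for m xs ys
    proof -
      have "length xs = N - m" using that by (simp add: av132_def length_perm_lists)
      moreover have "int N = r + (int N - int m) \<longleftrightarrow> int m = r" by auto
      ultimately show ?thesis using that(1)
        by (simp add: diag_hits_append diag_hits_map_add power_add of_nat_diff algebra_simps)
    qed
    let ?F = "\<lambda>m xs ys. (1 + t) ^ diag_hits (1 + (r - int m)) xs * (1 + t) ^ of_bool (int m = r) *
        (1 + t) ^ diag_hits (1 + (r + int N + 1 - int m)) ys"
    have "(\<Sum>xs\<in>av132 n. (1 + t) ^ diag_hits (1 + r) xs) =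
      (\<Sum>(m, xs, ys)\<in>(SIGMA m:{..N}. av132 (N - m) \<times> av132 m). ?F m xs ys)"
      unfolding Suc sum.reindex_bij_betw[OF bij_betw_av132_Suc, symmetric]
    proof (rule sum.cong[OF refl], goal_cases)
      case (1 p)
      obtain m xs ys where "p = (m, xs, ys)" by (cases p)
      then show ?case using 1 hits[of m xs ys] by (simp del: of_nat_Suc)
    qed
    also have "\<dots> = (\<Sum>m\<le>N. \<Sum>xs\<in>av132 (N - m). \<Sum>ys\<in>av132 m. ?F m xs ys)"
      by (simp add: sum.cartesian_product sum.Sigma)
    also have "\<dots> = (\<Sum>m\<le>N. (\<Sum>xs\<in>av132 (N - m). (1 + t) ^ diag_hits (1 + (r - int m)) xs) *
         (1 + t) ^ of_bool (int m = r) * (\<Sum>ys\<in>av132 m. (1 + t) ^ diag_hits (1 + (r + int N + 1 - int m)) ys))"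
      by (simp add: sum_distrib_left sum_distrib_right mult_ac)
    also have "\<dots> = (\<Sum>m\<le>N. (catalan (N - m) + t * ?A m) * (1 + t) ^ of_bool (int m = r) * (catalan m + t * ?B m))"
      by (intro sum.cong refl arg_cong2[of _ _ _ _ "(*)"] less) (auto simp: Suc)
    also have "\<dots> = (\<Sum>m\<le>N. catalan m * catalan (N - m) + t * (catalan m * ?A m + catalan (N - m) * ?B m +
        of_bool (int m = r) * catalan m * marked t (N - m)))"
    proof (rule sum.cong[OF refl])
      fix m assume "m \<in> {..N}"
      \<comment> \<open>Value minus position is at least \<open>2 * m - N + 1\<close> in front of
        the maximum and at most \<open>2 * m - N - 2\<close> behind it. A diagonal thus meets at
        most one of the two blocks, so the cross term \<open>?A m * ?B m\<close> vanishes.\<close>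
      then have "int m \<le> \<bar>r + int N + 1 - int m\<bar> \<or> int (N - m) \<le> \<bar>r - int m\<bar>" by auto
      then have AB: "?A m = 0 \<or> ?B m = 0" using marked_tail_eq_0 by blast
      show "(catalan (N - m) + t * ?A m) * (1 + t) ^ of_bool (int m = r) * (catalan m + t * ?B m) =
        catalan m * catalan (N - m) + t * (catalan m * ?A m + catalan (N - m) * ?B m +
        of_bool (int m = r) * catalan m * marked t (N - m))"
      proof (cases "int m = r")
        \<comment> \<open>The maximum is on the diagonal, so the front sees offset 0 and the back is
          missed. A mark on the maximum contributes the full weighted sum of the front, which is
          \<open>marked t (N - m)\<close>.\<close>
        case True
        then have "?B m = 0" using \<open>m \<in> {..N}\<close> by (intro marked_tail_eq_0) auto
        then show ?thesis using True by (simp add: marked_eq_tail[of t "N - m"] algebra_simps)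
      next
        case False
        then show ?thesis using AB by (auto simp: algebra_simps)
      qed
    qed
    also have "\<dots> = catalan n + t * marked_tail t n r"
      unfolding Suc marked_tail_convolution[symmetric] sum.distrib sum_distrib_left[symmetric] by simp
    finally show ?thesis .
  qed
qed

lemma sum_av132: "(\<Sum>xs\<in>av132 n. (1 + t) ^ diag_hits 1 xs) = marked t n"
  using sum_av132_diag[where r = 0] by (simp add: marked_eq_tail)

subsection \<open>Permutations avoiding 321\<close>

definition avoids_321 :: "int list \<Rightarrow> bool" where
  "avoids_321 xs \<longleftrightarrow> (\<forall>a b c. subseq [a, b, c] xs \<longrightarrow> \<not> (c < b \<and> b < a))"

definition av321 :: "nat \<Rightarrow> int list set" where
  "av321 n = {xs \<in> perm_lists n. avoids_321 xs}"

lemma finite_av321 [simp]: "finite (av321 n)"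
  by (simp add: av321_def)

lemma sorted_iff_subseq: "sorted xs \<longleftrightarrow> (\<forall>a b. subseq [a, b] xs \<longrightarrow> a \<le> b)"
proof (induction xs)
  case (Cons x xs)
  then show ?case unfolding subseq_triple_Cons by auto
qed simp

text \<open>A maximum can only be the first letter of a 321, so inserting it forbids exactly the
  descending pairs behind it.\<close>

lemma avoids_321_insert_max:
  assumes "\<And>x. x \<in> set xs \<union> set ys \<Longrightarrow> x < z"
  shows "avoids_321 (xs @ z # ys) \<longleftrightarrow> avoids_321 (xs @ ys) \<and> sorted ys"
proof
  assume av: "avoids_321 (xs @ z # ys)"
  have "avoids_321 (xs @ ys)"
    using av unfolding avoids_321_def subseq_triple_append subseq_triple_Cons by auto
  moreover have "a \<le> b" if ab: "subseq [a, b] ys" for a b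
  proof -
    have "subseq [z, a, b] (xs @ z # ys)"
      using ab by (simp add: subseq_triple_append)
    then show ?thesis
      using av assms[of a] subseq_mem(1)[OF ab] unfolding avoids_321_def by fastforce
  qed
  ultimately show "avoids_321 (xs @ ys) \<and> sorted ys" by (simp add: sorted_iff_subseq)
next
  assume av: "avoids_321 (xs @ ys) \<and> sorted ys"
  show "avoids_321 (xs @ z # ys)"
    unfolding avoids_321_def
  proof (intro allI impI)
    fix a b c assume abc: "subseq [a, b, c] (xs @ z # ys)"
    then consider "subseq [a, b, c] (xs @ ys)" | "a = z" "subseq [b, c] ys" | "b = z" "a \<in> set xs"
      | "c = z" "b \<in> set xs"
      unfolding subseq_triple_append subseq_triple_Cons using subseq_mem by fastforce
    then show "\<not> (c < b \<and> b < a)"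
    proof cases
      case 1 then show ?thesis using av unfolding avoids_321_def by blast
    next
      case 2 then show ?thesis using av unfolding sorted_iff_subseq by fastforce
    next
      case 3 then show ?thesis using assms[of a] by auto
    next
      case 4 then show ?thesis using assms[of b] by auto
    qed
  qed
qed

lemma perm_lists_insert_max:
  "xs @ int (Suc n) # ys \<in> perm_lists (Suc n) \<longleftrightarrow> xs @ ys \<in> perm_lists n"
proof -
  define z where "z = int (Suc n)"
  have Icc: "{1..int (Suc n)} = insert z {1..int n}" and z: "z \<notin> {1..int n}"
    by (auto simp: z_def)
  show ?thesis
  proof (cases "z \<in> set (xs @ ys)")
    case True
    then have "xs @ ys \<notin> perm_lists n" "xs @ z # ys \<notin> perm_lists (Suc n)"
      using z unfolding perm_lists_def by (blast, auto)
    then show ?thesis unfolding z_def by blast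
  next
    case False
    have "set (xs @ z # ys) = insert z (set (xs @ ys))" by simp
    then have "set (xs @ z # ys) = {1..int (Suc n)} \<longleftrightarrow> set (xs @ ys) = {1..int n}"
      unfolding Icc by (simp only: insert_ident[OF False z])
    moreover have "distinct (xs @ z # ys) \<longleftrightarrow> distinct (xs @ ys)" using False by auto
    ultimately show ?thesis unfolding perm_lists_def z_def by blast
  qed
qed

lemma perm_lists_less: "xs \<in> perm_lists n \<Longrightarrow> x \<in> set xs \<Longrightarrow> x < int (Suc n)"
  by (auto simp: perm_lists_def)

lemma av321_insert_max:
  "xs @ int (Suc n) # ys \<in> av321 (Suc n) \<longleftrightarrow> xs @ ys \<in> av321 n \<and> sorted ys"
  using avoids_321_insert_max[of xs ys "int (Suc n)"] perm_lists_less[of "xs @ ys" n]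
  unfolding av321_def by (auto simp: perm_lists_insert_max simp del: of_nat_Suc)

text \<open>Where a new maximum may be inserted depends only on the increasing suffix. Refining by
  its length turns the count into a ballot array, whose column 0 counts all 321-avoiders.\<close>

definition av321_suffix :: "nat \<Rightarrow> nat \<Rightarrow> int list set" where
  "av321_suffix n j = {xs \<in> av321 n. sorted (drop (n - j) xs)}"

lemma finite_av321_suffix [simp]: "finite (av321_suffix n j)"
  by (simp add: av321_suffix_def)

lemma av321_suffix_full: "av321_suffix n n = {[1..int n]}"
proof -
  have "xs \<in> av321_suffix n n \<longleftrightarrow> xs = [1..int n]" for xs
  proof
    assume "xs \<in> av321_suffix n n"
    then show "xs = [1..int n]"
      by (intro sorted_distinct_set_unique) (auto simp: av321_suffix_def av321_def perm_lists_def)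
  next
    have "avoids_321 [1..int n]"
      using subseq_triple_append subseq_mem sorted_upto[of 1 "int n"]
      unfolding avoids_321_def sorted_iff_subseq
      by (metis linorder_not_le subseq_Cons' subseq_Cons2_iff)
    moreover assume "xs = [1..int n]"
    ultimately show "xs \<in> av321_suffix n n"
      by (auto simp: av321_suffix_def av321_def perm_lists_def)
  qed
  then show ?thesis by blast
qed

text \<open>Removing the maximum from a permutation whose longest increasing suffix has length exactly
  \<^term>\<open>Suc j\<close> leaves a permutation whose last \<^term>\<open>j\<close> entries increase; conversely the
  position of the maximum is determined by whether the last \<^term>\<open>Suc j\<close> entries of the
  remainder still increase.\<close>

lemma card_av321_suffix_Suc:
  assumes "j < n"
  shows "card (av321_suffix (Suc n) (Suc j)) =
    card (av321_suffix (Suc n) (Suc (Suc j))) + card (av321_suffix n j)"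
proof -
  define k where "k = n - Suc j"
  have k: "n - j = Suc k" "Suc n - Suc (Suc j) = k" "Suc n - Suc j = Suc k" "k < n"
    using assms by (auto simp: k_def)
  define z where "z = int (Suc n)"
  \<comment> \<open>Either choice leaves an increasing suffix of exactly \<open>Suc j\<close>
    entries: it is stopped by \<open>z\<close> in the first case and by the old failure at index
    \<open>k\<close>, now followed by \<open>z\<close> at the end, in the second.\<close>
  define g where "g ys = (if sorted (drop k ys) then take k ys @ z # drop k ys else ys @ [z])" for ys
  let ?T = "av321_suffix (Suc n) (Suc j) - av321_suffix (Suc n) (Suc (Suc j))"
  have zless: "x < z" if "ys \<in> av321 n" "x \<in> set ys" for x ys
    using that perm_lists_less unfolding z_def av321_def by blast
  have "bij_betw g (av321_suffix n j) ?T"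
  proof (rule bij_betw_byWitness[where f' = "remove1 z"])
    show "\<forall>ys\<in>av321_suffix n j. remove1 z (g ys) = ys"
    proof
      fix ys assume "ys \<in> av321_suffix n j"
      then have "z \<notin> set ys" using zless unfolding av321_suffix_def by blast
      then have "z \<notin> set (take k ys)" by (auto dest: in_set_takeD)
      then show "remove1 z (g ys) = ys" using \<open>z \<notin> set ys\<close> by (simp add: g_def remove1_append)
    qed
    show "g ` av321_suffix n j \<subseteq> ?T"
    proof (rule image_subsetI)
      fix ys assume ys: "ys \<in> av321_suffix n j"
      then have len: "length ys = n" and av: "ys \<in> av321 n" and s: "sorted (drop (Suc k) ys)"
        using length_perm_lists k by (auto simp: av321_suffix_def av321_def)
      show "g ys \<in> ?T"
      proof (cases "sorted (drop k ys)")
        case True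
        have g: "g ys = take k ys @ z # drop k ys" using True by (simp add: g_def)
        have "drop k ys \<noteq> []" using len k by simp
        then obtain y where y: "y \<in> set (drop k ys)" by fastforce
        then have "y < z" using zless[OF av] in_set_dropD by fastforce
        then have "\<not> sorted (z # drop k ys)" using y by force
        moreover have "g ys \<in> av321 (Suc n)"
          unfolding g z_def av321_insert_max using True av by simp
        moreover have "drop (Suc k) (g ys) = drop k ys" "drop k (g ys) = z # drop k ys"
          unfolding g using len k by auto
        ultimately show ?thesis unfolding av321_suffix_def k using True by simp
      next
        case False
        have g: "g ys = ys @ [z]" using False by (simp add: g_def)
        have "g ys \<in> av321 (Suc n)"
          unfolding g z_def av321_insert_max using av by simp
        moreover have "drop (Suc k) (g ys) = drop (Suc k) ys @ [z]" "drop k (g ys) = drop k ys @ [z]"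
          unfolding g using len k by auto
        moreover have "sorted (drop (Suc k) ys @ [z])"
          unfolding sorted_append using s zless[OF av] by (auto dest!: in_set_dropD intro: less_imp_le)
        ultimately show ?thesis unfolding av321_suffix_def k using False by (simp add: sorted_append)
      qed
    qed
    show "\<forall>xs\<in>?T. g (remove1 z xs) = xs" and "remove1 z ` ?T \<subseteq> av321_suffix n j"
    proof -
      have "g (remove1 z xs) = xs \<and> remove1 z xs \<in> av321_suffix n j" if xs: "xs \<in> ?T" for xs
      proof -
        have av: "xs \<in> av321 (Suc n)" and s: "sorted (drop (Suc k) xs)" and ns: "\<not> sorted (drop k xs)"
          using xs k by (auto simp: av321_suffix_def)
        have "z \<in> set xs" using av by (auto simp: z_def av321_def perm_lists_def)
        then obtain as bs where split: "xs = as @ z # bs" by (auto dest: split_list)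
        have av': "as @ bs \<in> av321 n" "sorted bs"
          using av av321_insert_max unfolding split z_def by auto
        have less: "\<And>x. x \<in> set as \<union> set bs \<Longrightarrow> x < z"
          using zless[OF av'(1)] by auto
        have rem: "remove1 z xs = as @ bs"
          using less unfolding split by (force simp: remove1_append)
        have len: "length as + length bs = n"
          using av'(1) length_perm_lists by (fastforce simp: av321_def)
        show ?thesis
        proof (cases "bs = []")
          case True
          have "drop (Suc k) xs = drop (Suc k) as @ [z]" "drop k xs = drop k as @ [z]"
            using True len k unfolding split by auto
          moreover have "sorted (drop k as @ [z]) \<longleftrightarrow> sorted (drop k as)"
            unfolding sorted_append using less by (auto dest!: in_set_dropD intro: less_imp_le)
          ultimately show ?thesis
            using True av' s ns unfolding rem g_def av321_suffix_def k
            by (auto simp: split sorted_append)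
        next
          case False
          then obtain b where b: "b \<in> set bs" by fastforce
          \<comment> \<open>The maximum followed by anything is a descent, and \<open>bs\<close>
            increases, so the longest increasing suffix of \<open>xs\<close> starts right behind
            \<open>z\<close>.\<close>
          have "length as = k"
          proof (rule antisym)
            show "length as \<le> k"
            proof (rule ccontr)
              assume "\<not> length as \<le> k"
              then have "drop (Suc k) xs = drop (Suc k) as @ z # bs" unfolding split by simp
              then show False using s b less[of b] by (auto simp: sorted_append)
            qed
            show "k \<le> length as"
            proof (rule ccontr)
              assume "\<not> k \<le> length as"
              then have "drop k xs = drop (k - Suc (length as)) bs"
                unfolding split by (simp add: drop_Cons')
              then show False using ns av'(2) by (simp add: sorted_wrt_drop)
            qed
          qed
          then show ?thesis
            using av' unfolding rem g_def av321_suffix_def k by (auto simp: split sorted_wrt_drop)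
        qed
      qed
      then show "\<forall>xs\<in>?T. g (remove1 z xs) = xs" "remove1 z ` ?T \<subseteq> av321_suffix n j" by blast+
    qed
  qed
  then have "card ?T = card (av321_suffix n j)" by (simp add: bij_betw_same_card)
  moreover have sub: "av321_suffix (Suc n) (Suc (Suc j)) \<subseteq> av321_suffix (Suc n) (Suc j)"
  proof -
    have "drop (Suc k) xs = drop 1 (drop k xs)" for xs :: "int list" by simp
    then show ?thesis unfolding av321_suffix_def k using sorted_wrt_drop by (metis (no_types, lifting) Collect_mono)
  qed
  ultimately show ?thesis
    using card_Diff_subset[OF finite_av321_suffix sub] card_mono[OF finite_av321_suffix sub] by simp
qed

text \<open>Columns 0 and 1 agree because a single entry is always sorted. Beyond the diagonal
  \<open>n - j\<close> truncates and the set would still contain the identity; the guard supplies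
  the required zeros.\<close>

lemma ballot_array_av321_suffix:
  "ballot_array (\<lambda>n j. if j \<le> n then real (card (av321_suffix n j)) else 0)"
  unfolding ballot_array_def
proof (intro conjI allI impI)
  show "(if 0 \<le> (0::nat) then real (card (av321_suffix 0 0)) else 0) = 1"
    by (simp add: av321_suffix_full)
  show "(if 0 \<le> Suc n then real (card (av321_suffix (Suc n) 0)) else 0) =
      (if 1 \<le> Suc n then real (card (av321_suffix (Suc n) 1)) else 0)" for n
  proof -
    have "sorted (drop n xs)" "drop (Suc n) xs = []" if "xs \<in> av321 (Suc n)" for xs
    proof -
      have len: "length xs = Suc n" using that by (simp add: av321_def length_perm_lists)
      then show "drop (Suc n) xs = []" by simp
      have "length (drop n xs) = Suc 0" using len by simp
      then show "sorted (drop n xs)" by (metis length_0_conv length_Suc_conv sorted1)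
    qed
    then have "av321_suffix (Suc n) 0 = av321_suffix (Suc n) 1"
      unfolding av321_suffix_def by auto
    then show ?thesis by simp
  qed
  show "(if Suc j \<le> Suc n then real (card (av321_suffix (Suc n) (Suc j))) else 0) =
      (if Suc (Suc j) \<le> Suc n then real (card (av321_suffix (Suc n) (Suc (Suc j)))) else 0) +
      (if j \<le> n then real (card (av321_suffix n j)) else 0)" for n j
  proof -
    consider "j < n" | "j = n" | "n < j" by linarith
    then show ?thesis
      by cases (simp_all add: card_av321_suffix_Suc av321_suffix_full)
  qed
qed simp

lemma card_av321: "real (card (av321 n)) = catalan n"
proof -
  have "av321_suffix n 0 = av321 n"
    by (auto simp: av321_suffix_def av321_def length_perm_lists)
  then show ?thesis
    using ballot_array_unique[where n = n and j = 0, OF ballot_array_av321_suffix ballot_array_ballot]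
    by (simp add: ballot_0)
qed

section \<open>Fixed points of 321-avoiders\<close>

lemma avoids_321_map_add: "avoids_321 (map (\<lambda>x. x + c) xs) \<longleftrightarrow> avoids_321 xs"
proof -
  have "(\<exists>a' b' c'. subseq [a', b', c'] (map (\<lambda>x. x + c) xs) \<and> c' < b' \<and> b' < a') \<longleftrightarrow>
        (\<exists>a b d. subseq [a, b, d] xs \<and> d < b \<and> b < a)"
    unfolding subseq_map_iff by (fastforce simp: Cons_eq_map_conv map_eq_Cons_conv)
  then show ?thesis unfolding avoids_321_def by blast
qed

lemma avoids_321_direct_sum:
  assumes "\<And>x. x \<in> set xs \<Longrightarrow> x < z" "\<And>y. y \<in> set ys \<Longrightarrow> z < y"
  shows "avoids_321 (xs @ z # ys) \<longleftrightarrow> avoids_321 xs \<and> avoids_321 ys"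
proof
  assume "avoids_321 (xs @ z # ys)"
  then show "avoids_321 xs \<and> avoids_321 ys"
    unfolding avoids_321_def subseq_triple_append subseq_triple_Cons by blast
next
  assume av: "avoids_321 xs \<and> avoids_321 ys"
  show "avoids_321 (xs @ z # ys)"
    unfolding avoids_321_def
  proof (intro allI impI)
    fix a b c assume "subseq [a, b, c] (xs @ z # ys)"
    then consider "subseq [a, b, c] xs" | "a \<in> set xs" "c \<in> insert z (set ys)" | "a = z" "b \<in> set ys"
      | "subseq [a, b, c] ys"
      unfolding subseq_triple_append subseq_triple_Cons set_simps by (auto dest: subseq_mem)
    then show "\<not> (c < b \<and> b < a)"
    proof cases
      case 1 then show ?thesis using av unfolding avoids_321_def by blast
    next
      case 2 then show ?thesis using assms(1)[of a] assms(2)[of c] by auto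
    next
      case 3 then show ?thesis using assms(2)[of b] by auto
    next
      case 4 then show ?thesis using av unfolding avoids_321_def by blast
    qed
  qed
qed

lemma image_minus_Icc:
  fixes a b c :: int
  shows "(\<lambda>x. x - c) ` {a..b} = {a - c..b - c}"
  by (rule set_eqI) (auto simp: image_iff intro!: bexI[of _ "_ + c"])

text \<open>A fixed point of a 321-avoider separates it into a direct sum: all smaller values stand
  before it and all larger ones behind it.\<close>

lemma bij_betw_av321_fixed:
  "bij_betw (\<lambda>(xs, ys). xs @ (1 + int l) # map (\<lambda>x. x + (1 + int l)) ys)
     (av321 l \<times> av321 m) {zs \<in> av321 (Suc (l + m)). zs ! l = 1 + int l}"
  (is "bij_betw ?f _ ?T")
proof (rule bij_betwI')
  fix p q assume pq: "p \<in> av321 l \<times> av321 m" "q \<in> av321 l \<times> av321 m"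
  obtain xs ys us vs where eq: "p = (xs, ys)" "q = (us, vs)" by (cases p, cases q) auto
  then have "length xs = l" "length us = l" using pq length_perm_lists by (auto simp: av321_def)
  then show "?f p = ?f q \<longleftrightarrow> p = q" unfolding eq by (auto simp: inj_map_eq_map inj_on_def)
next
  fix p assume p: "p \<in> av321 l \<times> av321 m"
  obtain xs ys where eq: "p = (xs, ys)" by (cases p)
  have xs: "distinct xs" "set xs = {1..int l}" "avoids_321 xs" "length xs = l"
    and ys: "distinct ys" "set ys = {1..int m}" "avoids_321 ys"
    using p length_perm_lists unfolding eq by (auto simp: av321_def) (auto simp: perm_lists_def)
  have img: "(\<lambda>x. x + (1 + int l)) ` {1..int m} = {int l + 2..int (Suc (l + m))}"
    by (rule set_eqI) (auto simp: image_iff intro!: bexI[of _ "_ - (1 + int l)"])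
  have "avoids_321 (?f p)"
    unfolding eq prod.case
    by (subst avoids_321_direct_sum) (use xs ys in \<open>auto simp: avoids_321_map_add\<close>)
  moreover have "{1..int (Suc (l + m))} = {1..int l} \<union> insert (1 + int l) {int l + 2..int (Suc (l + m))}"
    by auto
  then have "?f p \<in> perm_lists (Suc (l + m))"
    unfolding eq perm_lists_def using xs ys img by (auto simp: distinct_map inj_on_def)
  ultimately show "?f p \<in> ?T"
    unfolding eq using xs(4) by (auto simp: av321_def nth_append)
next
  fix zs assume "zs \<in> ?T"
  then have zs: "distinct zs" "set zs = {1..int (Suc (l + m))}" "avoids_321 zs"
    and len: "length zs = Suc (l + m)" and hit: "zs ! l = 1 + int l"
    using length_perm_lists by (auto simp: av321_def) (auto simp: perm_lists_def)
  define xs where "xs = take l zs"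
  define ws where "ws = drop (Suc l) zs"
  have split: "zs = xs @ (1 + int l) # ws"
    unfolding xs_def ws_def hit[symmetric] by (rule id_take_nth_drop) (use len in simp)
  have lxs: "length xs = l" "length ws = m" using len by (auto simp: xs_def ws_def)
  have d: "distinct xs" "distinct ws" "set xs \<inter> set ws = {}" "1 + int l \<notin> set xs" "1 + int l \<notin> set ws"
    using zs(1) unfolding split by auto
  have ins: "insert (1 + int l) (set xs \<union> set ws) = {1..int (Suc (l + m))}"
    using zs(2) unfolding split by simp
  have card: "card (set xs) = l" using d lxs by (simp add: distinct_card)
  have "set xs \<subseteq> {1..int l}"
  proof
    fix u assume u: "u \<in> set xs"
    have "1 \<le> u" "u \<noteq> 1 + int l" using u ins d(4) by auto
    moreover have "\<not> 1 + int l < u"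
    proof
      assume less: "1 + int l < u"
      \<comment> \<open>Pigeonhole: one of the \<open>l\<close> entries of \<open>xs\<close> is
        \<open>u\<close>, which exceeds \<open>l\<close>, so some value \<open>v\<close> up to
        \<open>l\<close> is left for \<open>ws\<close>. Then \<open>u\<close>,
        \<open>1 + int l\<close>, \<open>v\<close> is a 321.\<close>
      have "\<not> {1..int l} \<subseteq> set xs"
      proof
        assume "{1..int l} \<subseteq> set xs"
        then have "{1..int l} = set xs" using card by (intro card_subset_eq) auto
        then have "u \<in> {1..int l}" using u by blast
        then show False using less by simp
      qed
      then obtain v where "v \<in> {1..int l}" and v: "v \<notin> set xs" by blast
      then have v': "1 \<le> v" "v \<le> int l" by auto
      then have "v \<in> insert (1 + int l) (set xs \<union> set ws)" unfolding ins using v' by simp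
      then have "v \<in> set ws" using v v' by auto
      then have "subseq [u, 1 + int l, v] zs"
        using u unfolding split by (simp add: subseq_triple_append subseq_singleton_left)
      then show False using zs(3) v' less unfolding avoids_321_def by fastforce
    qed
    ultimately show "u \<in> {1..int l}" by simp
  qed
  then have xs: "set xs = {1..int l}" using card by (intro card_subset_eq) auto
  have ws: "set ws = {int l + 2..int (Suc (l + m))}"
  proof -
    have "set ws = insert (1 + int l) (set xs \<union> set ws) - insert (1 + int l) (set xs)"
      using d by blast
    also have "\<dots> = {1..int (Suc (l + m))} - insert (1 + int l) {1..int l}"
      unfolding ins unfolding xs ..
    also have "\<dots> = {int l + 2..int (Suc (l + m))}" by auto
    finally show ?thesis .
  qed
  define ys where "ys = map (\<lambda>x. x - (1 + int l)) ws"
  have ws_ys: "ws = map (\<lambda>x. x + (1 + int l)) ys" by (simp add: ys_def o_def)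
  have "avoids_321 xs \<and> avoids_321 ws"
    using zs(3) avoids_321_direct_sum[of xs "1 + int l" ws] xs ws unfolding split by auto
  then have "xs \<in> av321 l" "ys \<in> av321 m"
  proof -
    have "set ys = {1..int m}" unfolding ys_def set_map ws image_minus_Icc by simp
    moreover have "distinct ys" using d(2) by (simp add: ys_def distinct_map inj_on_def)
    moreover assume "avoids_321 xs \<and> avoids_321 ws"
    ultimately show "xs \<in> av321 l" "ys \<in> av321 m"
      using xs d(1) unfolding ws_ys avoids_321_map_add by (auto simp: av321_def perm_lists_def)
  qed
  moreover have "zs = ?f (xs, ys)" unfolding split ws_ys by simp
  ultimately show "\<exists>p\<in>av321 l \<times> av321 m. zs = ?f p" by blast
qed

text \<open>Expanding the power over subsets of the diagonal entries and grouping by the largest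
  chosen one.\<close>

lemma power_diag_hits:
  "(1 + t :: real) ^ diag_hits s xs =
     1 + t * (\<Sum>l<length xs. of_bool (xs ! l = s + int l) * (1 + t) ^ diag_hits s (take l xs))"
proof (induction xs rule: rev_induct)
  case (snoc x xs)
  have "(\<Sum>l<length xs. of_bool ((xs @ [x]) ! l = s + int l) * (1 + t) ^ diag_hits s (take l (xs @ [x]))) =
        (\<Sum>l<length xs. of_bool (xs ! l = s + int l) * (1 + t) ^ diag_hits s (take l xs))"
    by (intro sum.cong) (auto simp: nth_append)
  then show ?case
    using snoc by (simp add: diag_hits_append algebra_simps)
qed simp

text \<open>Cut at the last marked fixed point: in front of it stands a smaller 321-avoider with
  marks, behind it one without, which \<open>card_av321\<close> counts. This is the recursion of
  \<open>marked\<close>.\<close>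

lemma sum_av321: "(\<Sum>xs\<in>av321 n. (1 + t) ^ diag_hits 1 xs) = marked t n"
proof (induction n rule: less_induct)
  case (less n)
  show ?case
  proof (cases n)
    case 0
    have "av321 0 = {[]}" by (auto simp: av321_def perm_lists_def avoids_321_def)
    then show ?thesis using 0 by simp
  next
    case (Suc N)
    have inner: "(\<Sum>zs\<in>av321 n. of_bool (zs ! l = 1 + int l) * (1 + t) ^ diag_hits 1 (take l zs)) =
        catalan (N - l) * marked t l" if "l \<le> N" for l
    proof -
      have n: "n = Suc (l + (N - l))" using that Suc by simp
      have "(\<Sum>zs\<in>av321 n. of_bool (zs ! l = 1 + int l) * (1 + t) ^ diag_hits 1 (take l zs)) =
          (\<Sum>zs\<in>{zs \<in> av321 n. zs ! l = 1 + int l}. (1 + t) ^ diag_hits 1 (take l zs))"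
        by (intro sum.mono_neutral_cong_right) auto
      also have "\<dots> = (\<Sum>(xs, ys)\<in>av321 l \<times> av321 (N - l). (1 + t) ^ diag_hits 1 xs)"
        unfolding n sum.reindex_bij_betw[OF bij_betw_av321_fixed[of l "N - l"], symmetric]
        by (intro sum.cong) (auto simp: av321_def length_perm_lists)
      also have "\<dots> = catalan (N - l) * marked t l"
        using less[of l] that Suc
        by (simp add: sum.cartesian_product[symmetric] card_av321 sum_distrib_left[symmetric])
      finally show ?thesis .
    qed
    have "(\<Sum>xs\<in>av321 n. (1 + t) ^ diag_hits 1 xs) =
      (\<Sum>xs\<in>av321 n. 1 + t * (\<Sum>l\<le>N. of_bool (xs ! l = 1 + int l) * (1 + t) ^ diag_hits 1 (take l xs)))"
    proof (rule sum.cong[OF refl])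
      fix xs assume "xs \<in> av321 n"
      then have "{..<length xs} = {..N}" by (auto simp: av321_def length_perm_lists Suc)
      then show "(1 + t) ^ diag_hits 1 xs =
        1 + t * (\<Sum>l\<le>N. of_bool (xs ! l = 1 + int l) * (1 + t) ^ diag_hits 1 (take l xs))"
        by (subst power_diag_hits) simp
    qed
    also have "\<dots> = catalan n + t * (\<Sum>l\<le>N. \<Sum>xs\<in>av321 n. of_bool (xs ! l = 1 + int l) * (1 + t) ^ diag_hits 1 (take l xs))"
      unfolding sum.distrib sum_distrib_left[symmetric] by (subst sum.swap) (simp add: card_av321)
    also have "\<dots> = catalan n + t * (\<Sum>l\<le>N. catalan (N - l) * marked t l)"
      using inner by simp
    also have "(\<Sum>l\<le>N. catalan (N - l) * marked t l) = (\<Sum>m\<le>N. catalan m * marked t (N - m))"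
      by (rule sum.reindex_bij_witness[of _ "\<lambda>m. N - m" "\<lambda>m. N - m"]) auto
    finally show ?thesis by (simp add: Suc)
  qed
qed

section \<open>The pattern 213 by symmetry\<close>

definition avoids_213 :: "int list \<Rightarrow> bool" where
  "avoids_213 xs \<longleftrightarrow> (\<forall>a b c. subseq [a, b, c] xs \<longrightarrow> \<not> (b < a \<and> a < c))"

definition av213 :: "nat \<Rightarrow> int list set" where
  "av213 n = {xs \<in> perm_lists n. avoids_213 xs}"

text \<open>Half-turn of the permutation diagram. It maps the main diagonal to itself, so the number
  of fixed points survives, and it exchanges 213 with 132.\<close>

definition reverse_complement :: "nat \<Rightarrow> int list \<Rightarrow> int list" where
  "reverse_complement n xs = rev (map (\<lambda>x. int (Suc n) - x) xs)"

lemma reverse_complement_twice: "reverse_complement n (reverse_complement n xs) = xs"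
  by (simp add: reverse_complement_def rev_map[symmetric] o_def)

lemma reverse_complement_perm_lists:
  "xs \<in> perm_lists n \<Longrightarrow> reverse_complement n xs \<in> perm_lists n"
proof -
  have "(\<lambda>x. int (Suc n) - x) ` {1..int n} = {1..int n}" by (simp add: image_diff_atLeastAtMost)
  then show "xs \<in> perm_lists n \<Longrightarrow> reverse_complement n xs \<in> perm_lists n"
    by (simp add: perm_lists_def reverse_complement_def distinct_map inj_on_def del: of_nat_Suc)
qed

lemma subseq_rev: "subseq (rev xs) (rev ys) \<longleftrightarrow> subseq xs ys"
proof -
  have *: "subseq (rev xs) (rev ys)" if "subseq xs ys" for xs ys :: "'a list"
    using that by (induction rule: list_emb.induct) (auto intro: list_emb_append_mono subseq_rev_drop_many)
  from *[of xs ys] *[of "rev xs" "rev ys"] show ?thesis by auto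
qed

lemma subseq_reverse_complement:
  "subseq [a, b, c] (reverse_complement n xs) \<longleftrightarrow>
   subseq [int (Suc n) - c, int (Suc n) - b, int (Suc n) - a] xs"
proof -
  have "subseq [a, b, c] (reverse_complement n xs) \<longleftrightarrow>
      subseq (rev [c, b, a]) (rev (map (\<lambda>x. int (Suc n) - x) xs))"
    by (simp add: reverse_complement_def)
  also have "\<dots> \<longleftrightarrow> subseq [c, b, a] (map (\<lambda>x. int (Suc n) - x) xs)"
    by (simp only: subseq_rev)
  also have "\<dots> \<longleftrightarrow> (\<exists>z1 z2 z3. c = int (Suc n) - z1 \<and> b = int (Suc n) - z2 \<and> a = int (Suc n) - z3 \<and> subseq [z1, z2, z3] xs)"
    unfolding subseq_map_iff by (fastforce simp: Cons_eq_map_conv)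
  also have "\<dots> \<longleftrightarrow> subseq [int (Suc n) - c, int (Suc n) - b, int (Suc n) - a] xs"
    by (auto simp del: of_nat_Suc) (metis diff_diff_eq2 add_diff_cancel_left' add.commute)
  finally show ?thesis .
qed

lemma bij_betw_reverse_complement: "bij_betw (reverse_complement n) (av213 n) (av132 n)"
proof (rule bij_betw_byWitness[where f' = "reverse_complement n"])
  have "avoids_132 (reverse_complement n xs)" if "avoids_213 xs" for xs
    unfolding avoids_132_def subseq_reverse_complement
    using that unfolding avoids_213_def by (metis diff_strict_left_mono)
  then show "reverse_complement n ` av213 n \<subseteq> av132 n"
    by (auto simp: av132_def av213_def reverse_complement_perm_lists)
  have "avoids_213 (reverse_complement n xs)" if "avoids_132 xs" for xs
    unfolding avoids_213_def subseq_reverse_complement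
    using that unfolding avoids_132_def by (metis diff_strict_left_mono)
  then show "reverse_complement n ` av132 n \<subseteq> av213 n"
    by (auto simp: av132_def av213_def reverse_complement_perm_lists)
qed (auto simp: reverse_complement_twice)

lemma sum_av213: "(\<Sum>xs\<in>av213 n. (1 + t) ^ diag_hits 1 xs) = marked t n"
proof -
  have "diag_hits 1 (reverse_complement n xs) = diag_hits 1 xs" if "xs \<in> av213 n" for xs
  proof -
    have "length xs = n" using that by (auto simp: av213_def length_perm_lists)
    then show ?thesis unfolding reverse_complement_def diag_hits_rev_map_diff by simp
  qed
  then show ?thesis
    unfolding sum_av132[symmetric] sum.reindex_bij_betw[OF bij_betw_reverse_complement, symmetric]
    by simp
qed

subsection \<open>Counting marked fixed points\<close>

definition one_line :: "nat \<Rightarrow> (nat \<Rightarrow> nat) \<Rightarrow> int list" where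
  "one_line n \<sigma> = map (\<lambda>i. int (\<sigma> i)) [1..<Suc n]"

lemma bij_betw_one_line: "bij_betw (one_line n) {\<sigma>. \<sigma> permutes {1..n}} (perm_lists n)"
proof (rule bij_betwI')
  fix \<sigma> \<rho> assume s: "\<sigma> \<in> {\<sigma>. \<sigma> permutes {1..n}}" "\<rho> \<in> {\<sigma>. \<sigma> permutes {1..n}}"
  show "one_line n \<sigma> = one_line n \<rho> \<longleftrightarrow> \<sigma> = \<rho>"
  proof
    assume "one_line n \<sigma> = one_line n \<rho>"
    then have "\<sigma> i = \<rho> i" if "i \<in> {1..n}" for i
      using that by (auto simp: one_line_def map_eq_conv simp del: upt_Suc)
    moreover have "\<sigma> i = \<rho> i" if "i \<notin> {1..n}" for i
      using that s by (metis mem_Collect_eq permutes_not_in)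
    ultimately show "\<sigma> = \<rho>" by blast
  qed simp
next
  fix \<sigma> assume "\<sigma> \<in> {\<sigma>. \<sigma> permutes {1..n}}"
  then have s: "\<sigma> permutes {1..n}" by simp
  have "set (one_line n \<sigma>) = int ` \<sigma> ` {1..n}"
    by (auto simp: one_line_def image_image atLeastLessThanSuc_atLeastAtMost simp del: upt_Suc)
  also have "\<dots> = {1..int n}"
    unfolding permutes_image[OF s] by (simp add: image_int_atLeastAtMost)
  finally show "one_line n \<sigma> \<in> perm_lists n"
    using permutes_inj[OF s]
    by (auto simp: perm_lists_def one_line_def distinct_map inj_on_def inj_def simp del: upt_Suc)
next
  fix xs assume xs: "xs \<in> perm_lists n"
  define \<sigma> where "\<sigma> i = (if i \<in> {1..n} then nat (xs ! (i - 1)) else i)" for i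
  have len: "length xs = n" using xs by (rule length_perm_lists)
  have mem: "xs ! (i - 1) \<in> {1..int n}" if "i \<in> {1..n}" for i
  proof -
    have "xs ! (i - 1) \<in> set xs" using that len by (intro nth_mem) auto
    then show ?thesis using xs by (simp add: perm_lists_def)
  qed
  have "inj_on \<sigma> {1..n}"
  proof (rule inj_onI)
    fix i j assume ij: "i \<in> {1..n}" "j \<in> {1..n}" "\<sigma> i = \<sigma> j"
    then have "xs ! (i - 1) = xs ! (j - 1)"
      using mem[OF ij(1)] mem[OF ij(2)] by (simp add: \<sigma>_def eq_nat_nat_iff)
    then have "i - 1 = j - 1"
      using ij xs len by (subst (asm) nth_eq_iff_index_eq) (auto simp: perm_lists_def)
    then show "i = j" using ij by auto
  qed
  moreover have "\<sigma> ` {1..n} \<subseteq> {1..n}"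
  proof (rule image_subsetI)
    fix i assume i: "i \<in> {1..n}"
    then show "\<sigma> i \<in> {1..n}" using mem[OF i] by (simp add: \<sigma>_def) linarith
  qed
  ultimately have "bij_betw \<sigma> {1..n} {1..n}"
    by (simp add: bij_betw_def endo_inj_surj)
  then have "\<sigma> permutes {1..n}"
    by (rule bij_imp_permutes) (auto simp: \<sigma>_def)
  moreover have "xs = one_line n \<sigma>"
  proof (rule nth_equalityI)
    show "length xs = length (one_line n \<sigma>)" using len by (simp add: one_line_def)
    fix i assume "i < length xs"
    then show "xs ! i = one_line n \<sigma> ! i"
      using mem[of "Suc i"] len by (simp add: one_line_def \<sigma>_def del: upt_Suc)
  qed
  ultimately show "\<exists>\<sigma>\<in>{\<sigma>. \<sigma> permutes {1..n}}. xs = one_line n \<sigma>" by blast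
qed

lemma diag_hits_one_line: "diag_hits 1 (one_line n \<sigma>) = fixpoints n \<sigma>"
proof (induction n)
  case (Suc n)
  have "{i \<in> {1..Suc n}. \<sigma> i = i} = {i \<in> {1..n}. \<sigma> i = i} \<union> (if \<sigma> (Suc n) = Suc n then {Suc n} else {})"
    by (auto simp: le_Suc_eq)
  then have "fixpoints (Suc n) \<sigma> = fixpoints n \<sigma> + of_bool (\<sigma> (Suc n) = Suc n)"
    by (simp add: fixpoints_def)
  moreover have "one_line (Suc n) \<sigma> = one_line n \<sigma> @ [int (\<sigma> (Suc n))]"
    by (simp add: one_line_def)
  moreover have "length (one_line n \<sigma>) = n" by (simp add: one_line_def)
  moreover have "int (\<sigma> (Suc n)) = 1 + int n \<longleftrightarrow> \<sigma> (Suc n) = Suc n" by linarith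
  ultimately show ?case using Suc by (simp add: diag_hits_append)
qed (simp add: one_line_def fixpoints_def)

lemma subseq_triple_upt:
  "subseq [i, j] [1..<Suc n] \<longleftrightarrow> 1 \<le> i \<and> i < j \<and> j \<le> n"
  "subseq [i, j, k] [1..<Suc n] \<longleftrightarrow> 1 \<le> i \<and> i < j \<and> j < k \<and> k \<le> n"
proof -
  show 2: "subseq [i, j] [1..<Suc n] \<longleftrightarrow> 1 \<le> i \<and> i < j \<and> j \<le> n" for i j n
  proof (induction n)
    case (Suc n)
    have upt: "[1..<Suc (Suc n)] = [1..<Suc n] @ [Suc n]" by simp
    show ?case unfolding upt subseq_triple_append(1) Suc
      by (auto simp: subseq_singleton_left simp del: upt_Suc)
  qed simp
  show "subseq [i, j, k] [1..<Suc n] \<longleftrightarrow> 1 \<le> i \<and> i < j \<and> j < k \<and> k \<le> n"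
  proof (induction n)
    case (Suc n)
    have upt: "[1..<Suc (Suc n)] = [1..<Suc n] @ [Suc n]" by simp
    show ?case unfolding upt subseq_triple_append(2) Suc 2
      by (auto simp: subseq_singleton_left simp del: upt_Suc)
  qed simp
qed

lemma subseq_one_line:
  "subseq [a, b, c] (one_line n \<sigma>) \<longleftrightarrow>
   (\<exists>i j k. 1 \<le> i \<and> i < j \<and> j < k \<and> k \<le> n \<and> a = int (\<sigma> i) \<and> b = int (\<sigma> j) \<and> c = int (\<sigma> k))"
proof -
  have "subseq [a, b, c] (one_line n \<sigma>) \<longleftrightarrow>
    (\<exists>i j k. a = int (\<sigma> i) \<and> b = int (\<sigma> j) \<and> c = int (\<sigma> k) \<and> subseq [i, j, k] [1..<Suc n])"
    unfolding one_line_def subseq_map_iff by (fastforce simp: Cons_eq_map_conv simp del: upt_Suc)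
  then show ?thesis unfolding subseq_triple_upt by blast
qed

text \<open>Both directions of each comparison are kept because the letters are arbitrary and may
  coincide.\<close>

lemma contains_pattern_triple:
  "contains_pattern n \<sigma> [p, q, r] \<longleftrightarrow>
   (\<exists>i j k. 1 \<le> i \<and> i < j \<and> j < k \<and> k \<le> n \<and>
      (\<sigma> i < \<sigma> j \<longleftrightarrow> p < q) \<and> (\<sigma> i < \<sigma> k \<longleftrightarrow> p < r) \<and> (\<sigma> j < \<sigma> k \<longleftrightarrow> q < r) \<and>
      (\<sigma> j < \<sigma> i \<longleftrightarrow> q < p) \<and> (\<sigma> k < \<sigma> i \<longleftrightarrow> r < p) \<and> (\<sigma> k < \<sigma> j \<longleftrightarrow> r < q))"
  (is "_ \<longleftrightarrow> (\<exists>i j k. ?P i j k)")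
proof
  have all3: "(\<forall>j<length [p, q, r]. Q j) \<longleftrightarrow> Q 0 \<and> Q 1 \<and> Q 2" for Q :: "nat \<Rightarrow> bool"
    by (auto simp: less_Suc_eq numeral_2_eq_2)
  assume "contains_pattern n \<sigma> [p, q, r]"
  then obtain idx where 1: "\<forall>j<length [p, q, r]. idx j \<in> {1..n}"
    and 2: "\<forall>j k. j < k \<and> k < length [p, q, r] \<longrightarrow> idx j < idx k"
    and 3: "\<forall>j<length [p, q, r]. \<forall>k<length [p, q, r]. (\<sigma> (idx j) < \<sigma> (idx k)) = ([p, q, r] ! j < [p, q, r] ! k)"
    unfolding contains_pattern_def by blast
  have "idx 0 < idx 1" "idx 1 < idx 2" using 2 by auto
  moreover have "idx 0 \<in> {1..n}" "idx 2 \<in> {1..n}" using 1 unfolding all3 by auto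
  ultimately have "?P (idx 0) (idx 1) (idx 2)" using 3 unfolding all3 by simp
  then show "\<exists>i j k. ?P i j k" by blast
next
  assume "\<exists>i j k. ?P i j k"
  then obtain i j k where P: "?P i j k" by blast
  show "contains_pattern n \<sigma> [p, q, r]"
    unfolding contains_pattern_def
    by (rule exI[of _ "\<lambda>l. [i, j, k] ! l"]) (use P in \<open>auto simp: less_Suc_eq nth_Cons'\<close>)
qed

lemma one_line_avoids:
  "contains_pattern n \<sigma> [1,3,2] \<longleftrightarrow> \<not> avoids_132 (one_line n \<sigma>)"
  "contains_pattern n \<sigma> [3,2,1] \<longleftrightarrow> \<not> avoids_321 (one_line n \<sigma>)"
  "contains_pattern n \<sigma> [2,1,3] \<longleftrightarrow> \<not> avoids_213 (one_line n \<sigma>)"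
proof -
  have "contains_pattern n \<sigma> [1,3,2] \<longleftrightarrow>
      (\<exists>i j k. 1 \<le> i \<and> i < j \<and> j < k \<and> k \<le> n \<and> \<sigma> i < \<sigma> k \<and> \<sigma> k < \<sigma> j)"
    unfolding contains_pattern_triple by (intro ex_cong1) auto
  also have "\<dots> \<longleftrightarrow> (\<exists>a b c. subseq [a, b, c] (one_line n \<sigma>) \<and> a < c \<and> c < b)"
    unfolding subseq_one_line by (metis of_nat_less_iff)
  finally show "contains_pattern n \<sigma> [1,3,2] \<longleftrightarrow> \<not> avoids_132 (one_line n \<sigma>)"
    unfolding avoids_132_def by blast
  have "contains_pattern n \<sigma> [3,2,1] \<longleftrightarrow>
      (\<exists>i j k. 1 \<le> i \<and> i < j \<and> j < k \<and> k \<le> n \<and> \<sigma> k < \<sigma> j \<and> \<sigma> j < \<sigma> i)"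
    unfolding contains_pattern_triple by (intro ex_cong1) auto
  also have "\<dots> \<longleftrightarrow> (\<exists>a b c. subseq [a, b, c] (one_line n \<sigma>) \<and> c < b \<and> b < a)"
    unfolding subseq_one_line by (metis of_nat_less_iff)
  finally show "contains_pattern n \<sigma> [3,2,1] \<longleftrightarrow> \<not> avoids_321 (one_line n \<sigma>)"
    unfolding avoids_321_def by blast
  have "contains_pattern n \<sigma> [2,1,3] \<longleftrightarrow>
      (\<exists>i j k. 1 \<le> i \<and> i < j \<and> j < k \<and> k \<le> n \<and> \<sigma> j < \<sigma> i \<and> \<sigma> i < \<sigma> k)"
    unfolding contains_pattern_triple by (intro ex_cong1) auto
  also have "\<dots> \<longleftrightarrow> (\<exists>a b c. subseq [a, b, c] (one_line n \<sigma>) \<and> b < a \<and> a < c)"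
    unfolding subseq_one_line by (metis of_nat_less_iff)
  finally show "contains_pattern n \<sigma> [2,1,3] \<longleftrightarrow> \<not> avoids_213 (one_line n \<sigma>)"
    unfolding avoids_213_def by blast
qed

lemma sum_avoiders_eq:
  fixes f :: "nat \<Rightarrow> real"
  assumes "\<And>\<sigma>. contains_pattern n \<sigma> \<tau> \<longleftrightarrow> \<not> P (one_line n \<sigma>)"
  shows "(\<Sum>\<sigma>\<in>avoiders n \<tau>. f (fixpoints n \<sigma>)) = (\<Sum>xs\<in>{xs \<in> perm_lists n. P xs}. f (diag_hits 1 xs))"
proof -
  have "bij_betw (one_line n) (avoiders n \<tau>) {xs \<in> perm_lists n. P xs}"
    using bij_betw_one_line[of n] assms unfolding bij_betw_def avoiders_def inj_on_def by auto
  from sum.reindex_bij_betw[OF this, of "\<lambda>xs. f (diag_hits 1 xs)"] show ?thesis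
    by (simp add: diag_hits_one_line)
qed

lemma partition_fn_eq:
  assumes "\<tau> \<in> {[1,3,2], [3,2,1], [2,1,3]}"
  shows "partition_fn (1 + t) n \<tau> = (\<Sum>k\<le>n. ballot n k * t ^ k)"
proof -
  have "partition_fn (1 + t) n \<tau> = marked t n"
    using assms unfolding partition_fn_def
    using sum_avoiders_eq[where f = "\<lambda>k. (1 + t) ^ k" and n = n, OF one_line_avoids(1)] sum_av132[of t n]
      sum_avoiders_eq[where f = "\<lambda>k. (1 + t) ^ k" and n = n, OF one_line_avoids(2)] sum_av321[of t n]
      sum_avoiders_eq[where f = "\<lambda>k. (1 + t) ^ k" and n = n, OF one_line_avoids(3)] sum_av213[of t n]
    by (auto simp: av132_def av321_def av213_def)
  then show ?thesis by (simp add: marked_eq_ballot)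
qed

lemma finite_avoiders [simp]: "finite (avoiders n \<tau>)"
  by (rule finite_subset[OF _ finite_permutations[of "{1..n}"]]) (auto simp: avoiders_def)

lemma fixpoints_le: "fixpoints n \<sigma> \<le> n"
proof -
  have "fixpoints n \<sigma> \<le> card {1..n}"
    unfolding fixpoints_def by (rule card_mono) auto
  then show ?thesis by simp
qed

text \<open>The left side counts avoiders with \<open>k\<close> marked fixed points. It is the
  coefficient of t^k in \<open>partition_fn (1 + t) n \<tau>\<close>, and polynomials that agree for
  all real \<open>t\<close> have equal coefficients.\<close>

lemma sum_choose_fixpoints:
  assumes "\<tau> \<in> {[1,3,2], [3,2,1], [2,1,3]}" "k \<le> n"
  shows "(\<Sum>\<sigma>\<in>avoiders n \<tau>. real (fixpoints n \<sigma> choose k)) = ballot n k"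
proof -
  have "(\<Sum>k\<le>n. (\<Sum>\<sigma>\<in>avoiders n \<tau>. real (fixpoints n \<sigma> choose k)) * t ^ k) = (\<Sum>k\<le>n. ballot n k * t ^ k)" for t
  proof -
    have "(1 + t) ^ fixpoints n \<sigma> = (\<Sum>k\<le>n. real (fixpoints n \<sigma> choose k) * t ^ k)" for \<sigma>
    proof -
      have "(1 + t) ^ fixpoints n \<sigma> = (\<Sum>k\<le>fixpoints n \<sigma>. real (fixpoints n \<sigma> choose k) * t ^ k)"
        using binomial_ring[of t 1 "fixpoints n \<sigma>"] by (simp add: add.commute)
      also have "\<dots> = (\<Sum>k\<le>n. real (fixpoints n \<sigma> choose k) * t ^ k)"
        by (rule sum.mono_neutral_left) (use fixpoints_le[of n \<sigma>] in auto)
      finally show ?thesis .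
    qed
    then have "partition_fn (1 + t) n \<tau> = (\<Sum>\<sigma>\<in>avoiders n \<tau>. \<Sum>k\<le>n. real (fixpoints n \<sigma> choose k) * t ^ k)"
      by (simp add: partition_fn_def)
    also have "\<dots> = (\<Sum>k\<le>n. (\<Sum>\<sigma>\<in>avoiders n \<tau>. real (fixpoints n \<sigma> choose k)) * t ^ k)"
      by (subst sum.swap) (simp add: sum_distrib_right)
    finally show ?thesis using partition_fn_eq[OF assms(1), of t n] by simp
  qed
  then show ?thesis
    using polyfun_eq_coeffs[of "\<lambda>k. \<Sum>\<sigma>\<in>avoiders n \<tau>. real (fixpoints n \<sigma> choose k)" n "ballot n"] assms(2)
    by blast
qed

subsection \<open>The law of the number of marks\<close>

definition mark_tail :: "nat \<Rightarrow> nat \<Rightarrow> real" where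
  "mark_tail n m = (\<Sum>k=m..n. ballot n k * 2 ^ k) / (\<Sum>k\<le>n. ballot n k * 2 ^ k)"

text \<open>Telescoping, and the place where the weight must be 2: by Pascal's rule,
  \<open>ballot n m\<close> is (2n+1-m choose n+1) minus twice (2n-m choose n+1).\<close>

lemma sum_ballot_power_two:
  "m \<le> Suc n \<Longrightarrow> (\<Sum>k=m..n. ballot n k * 2 ^ k) = 2 ^ m * real ((2 * n + 1 - m) choose (Suc n))"
proof (induction m rule: inc_induct)
  case (step m)
  then have "m \<le> n" by simp
  then have "2 * n + 1 - m = Suc (2 * n - m)" "2 * n + 1 - Suc m = 2 * n - m" by auto
  then show ?case
    using step.IH \<open>m \<le> n\<close> by (simp add: sum.atLeast_Suc_atMost ballot_def algebra_simps)
qed simp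

text \<open>The absorption identity for binomials makes the ratio of consecutive tails rational, so
  the asymptotics can be read off factor by factor.\<close>

lemma mark_tail_prod:
  assumes "m \<le> n"
  shows "mark_tail n m = (\<Prod>i<m. 2 * (real n - real i) / (2 * real n + 1 - real i))"
  using assms
proof (induction m)
  case 0
  have "(\<Sum>k\<le>n. ballot n k * 2 ^ k) \<noteq> 0"
    using sum_ballot_power_two[of 0 n] by (simp add: atMost_atLeast0 add_nonneg_eq_0_iff)
  then show ?case by (simp add: mark_tail_def atMost_atLeast0)
next
  case (Suc m)
  define Z where "Z = (\<Sum>k\<le>n. ballot n k * 2 ^ k)"
  have m: "m \<le> n" "2 * n + 1 - m - Suc n = n - m" "2 * n + 1 - m - 1 = 2 * n - m" using Suc.prems by auto
  have "(n - m) * ((2 * n + 1 - m) choose Suc n) = (2 * n + 1 - m) * ((2 * n - m) choose Suc n)"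
    using binomial_absorb_comp[of "2 * n + 1 - m" "Suc n"] unfolding m .
  then have "real (n - m) * real ((2 * n + 1 - m) choose Suc n) = real (2 * n + 1 - m) * real ((2 * n - m) choose Suc n)"
    by (metis of_nat_mult)
  then have "real ((2 * n - m) choose Suc n) =
      real ((2 * n + 1 - m) choose Suc n) * ((real n - real m) / (2 * real n + 1 - real m))"
    using m(1) by (simp add: field_simps of_nat_diff)
  moreover have "mark_tail n m = 2 ^ m * real ((2 * n + 1 - m) choose (Suc n)) / Z"
    "mark_tail n (Suc m) = 2 ^ Suc m * real ((2 * n - m) choose (Suc n)) / Z"
    using sum_ballot_power_two[of m n] sum_ballot_power_two[of "Suc m" n] Suc.prems
    by (simp_all add: mark_tail_def Z_def)
  ultimately have "mark_tail n (Suc m) = mark_tail n m * (2 * (real n - real m) / (2 * real n + 1 - real m))"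
    by (simp add: algebra_simps)
  then show ?case using Suc by simp
qed

lemma sum_Suc_lessThan: "(\<Sum>i<m. real i + 1) = real m * (real m + 1) / 2"
  by (induction m) (simp_all add: field_simps)

text \<open>Each factor is 1 - (i+1)/(2n+1-i), bounded through 1 - u \<le> exp(-u) after enlarging
  the denominator to 2n+1.\<close>

lemma mark_tail_upper:
  assumes "m \<le> n"
  shows "mark_tail n m \<le> exp (- (real m * (real m + 1) / (2 * (2 * real n + 1))))"
proof -
  have "mark_tail n m \<le> (\<Prod>i<m. exp (- ((real i + 1) / (2 * real n + 1))))"
    unfolding mark_tail_prod[OF assms]
  proof (intro prod_mono conjI)
    fix i assume "i \<in> {..<m}"
    then have i: "real i + 1 \<le> real n" using assms by simp
    then show "0 \<le> 2 * (real n - real i) / (2 * real n + 1 - real i)" by simp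
    have "2 * (real n - real i) / (2 * real n + 1 - real i) = 1 - (real i + 1) / (2 * real n + 1 - real i)"
      using i by (simp add: field_simps)
    also have "\<dots> \<le> 1 - (real i + 1) / (2 * real n + 1)"
      using i by (intro diff_left_mono divide_left_mono) auto
    also have "\<dots> \<le> exp (- ((real i + 1) / (2 * real n + 1)))"
      using exp_ge_add_one_self[of "- ((real i + 1) / (2 * real n + 1))"] by simp
    finally show "2 * (real n - real i) / (2 * real n + 1 - real i) \<le> exp (- ((real i + 1) / (2 * real n + 1)))" .
  qed
  also have "\<dots> = exp (- (real m * (real m + 1) / (2 * (2 * real n + 1))))"
    by (simp add: exp_sum[symmetric] sum_negf sum_divide_distrib[symmetric] sum_Suc_lessThan)
  finally show ?thesis .
qed

text \<open>Each factor is 1/(1+z) with z = (i+1)/(2(n-i)), hence at least exp(-z);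
  \<open>n - m\<close> then replaces \<open>n - i\<close> to make the denominators equal.\<close>

lemma mark_tail_lower:
  assumes "m < n"
  shows "exp (- (real m * (real m + 1) / (4 * (real n - real m)))) \<le> mark_tail n m"
proof -
  have "exp (- (real m * (real m + 1) / (4 * (real n - real m)))) =
      (\<Prod>i<m. exp (- ((real i + 1) / (2 * (real n - real m)))))"
    by (simp add: exp_sum[symmetric] sum_negf sum_divide_distrib[symmetric] sum_Suc_lessThan)
  also have "\<dots> \<le> mark_tail n m"
    unfolding mark_tail_prod[OF less_imp_le[OF assms]]
  proof (intro prod_mono conjI)
    fix i assume "i \<in> {..<m}"
    then have i: "real i + 1 \<le> real m" "real m < real n" using assms by auto
    define z where "z = (real i + 1) / (2 * (real n - real i))"
    have "0 < z" using i by (simp add: z_def)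
    have "z \<le> (real i + 1) / (2 * (real n - real m))"
      unfolding z_def using i by (intro divide_left_mono) auto
    then have "exp (- ((real i + 1) / (2 * (real n - real m)))) \<le> exp (- z)" by simp
    also have "\<dots> = 1 / exp z" by (simp add: exp_minus divide_inverse)
    also have "\<dots> \<le> 1 / (1 + z)"
      using \<open>0 < z\<close> exp_ge_add_one_self[of z] by (intro divide_left_mono) auto
    also have "\<dots> = 2 * (real n - real i) / (2 * real n + 1 - real i)"
      using i by (simp add: z_def field_simps)
    finally show "exp (- ((real i + 1) / (2 * (real n - real m)))) \<le>
        2 * (real n - real i) / (2 * real n + 1 - real i)" .
  qed simp
  finally show ?thesis .
qed

text \<open>Written in \<open>b n = a n / sqrt n\<close>, the exponents of both bounds are
  continuous expressions with limit -c^2/4.\<close>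

lemma mark_tail_tendsto:
  fixes a :: "nat \<Rightarrow> nat"
  assumes a: "(\<lambda>n. real (a n) / sqrt (real n)) \<longlonglongrightarrow> c"
  shows "(\<lambda>n. mark_tail n (a n)) \<longlonglongrightarrow> exp (- c\<^sup>2 / 4)"
proof (rule tendsto_sandwich)
  define b where "b n = real (a n) / sqrt (real n)" for n
  have b: "b \<longlonglongrightarrow> c" using a by (simp add: b_def[abs_def])
  have inv: "(\<lambda>n. 1 / sqrt (real n)) \<longlonglongrightarrow> 0" by real_asymp
  have "(\<lambda>n. b n * (1 / sqrt (real n))) \<longlonglongrightarrow> c * 0" by (intro tendsto_mult b inv)
  then have small: "(\<lambda>n. b n * (1 / sqrt (real n))) \<longlonglongrightarrow> 0" by simp
  \<comment> \<open>Since \<open>a n\<close> is at most of order sqrt n, it eventually lies in the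
    range of both product bounds.\<close>
  have ev: "\<forall>\<^sub>F n in sequentially. 0 < n \<and> a n < n"
    using order_tendstoD(2)[OF small zero_less_one] eventually_gt_at_top[of 0]
  proof eventually_elim
    case (elim n)
    then have "b n * (1 / sqrt (real n)) = real (a n) / real n" by (simp add: b_def)
    then show ?case using elim by simp
  qed
  have bb: "b n * (b n + 1 / sqrt (real n)) = real (a n) * (real (a n) + 1) / real n"
    and b1: "b n * (1 / sqrt (real n)) = real (a n) / real n" if "0 < n" for n
    using that by (simp_all add: b_def field_simps)
  show "\<forall>\<^sub>F n in sequentially. mark_tail n (a n) \<le> exp (- (b n * (b n + 1 / sqrt (real n)) / (2 * (2 + 1 / real n))))"
    using ev
  proof eventually_elim
    case (elim n)
    have "real (a n) * (real (a n) + 1) / (2 * (2 * real n + 1)) =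
        b n * (b n + 1 / sqrt (real n)) / (2 * (2 + 1 / real n))"
    proof -
      have "2 * (2 + 1 / real n) = 2 * (2 * real n + 1) / real n" using elim by (simp add: field_simps)
      then show ?thesis using elim by (simp only: bb) simp
    qed
    then show ?case using mark_tail_upper[of "a n" n] elim by simp
  qed
  show "\<forall>\<^sub>F n in sequentially. exp (- (b n * (b n + 1 / sqrt (real n)) / (4 * (1 - b n * (1 / sqrt (real n)))))) \<le> mark_tail n (a n)"
    using ev
  proof eventually_elim
    case (elim n)
    have "real (a n) * (real (a n) + 1) / (4 * (real n - real (a n))) =
        b n * (b n + 1 / sqrt (real n)) / (4 * (1 - b n * (1 / sqrt (real n))))"
    proof -
      have "4 * (1 - real (a n) / real n) = 4 * (real n - real (a n)) / real n" using elim by (simp add: field_simps)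
      then show ?thesis using elim by (simp only: bb b1) simp
    qed
    then show ?case using mark_tail_lower[of "a n" n] elim by simp
  qed
  have "(\<lambda>n. exp (- (b n * (b n + 1 / sqrt (real n)) / (2 * (2 + 1 / real n))))) \<longlonglongrightarrow>
      exp (- (c * (c + 0) / (2 * (2 + 0))))"
    by (intro tendsto_intros b inv lim_1_over_n) simp
  then show "(\<lambda>n. exp (- (b n * (b n + 1 / sqrt (real n)) / (2 * (2 + 1 / real n))))) \<longlonglongrightarrow> exp (- c\<^sup>2 / 4)"
    by (simp add: power2_eq_square)
  have "(\<lambda>n. exp (- (b n * (b n + 1 / sqrt (real n)) / (4 * (1 - b n * (1 / sqrt (real n))))))) \<longlonglongrightarrow>
      exp (- (c * (c + 0) / (4 * (1 - 0))))"
    by (intro tendsto_intros b inv small) simp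
  then show "(\<lambda>n. exp (- (b n * (b n + 1 / sqrt (real n)) / (4 * (1 - b n * (1 / sqrt (real n))))))) \<longlonglongrightarrow> exp (- c\<^sup>2 / 4)"
    by (simp add: power2_eq_square)
qed

section \<open>Concentration of the marks given the fixed points\<close>

text \<open>\<open>Bernstein j k x\<close> is the probability that a binomial variable with
  parameters \<open>j\<close> and \<open>x\<close> equals \<open>k\<close>; the variance is
  assembled from its factorial moments.\<close>

lemma Bernstein_variance:
  "(\<Sum>k\<le>j. (real k - real j * x)\<^sup>2 * Bernstein j k x) = real j * x * (1 - x)"
proof -
  have "(\<Sum>k\<le>j. (real k - real j * x)\<^sup>2 * Bernstein j k x) =
      (\<Sum>k\<le>j. real k * (real k - 1) * Bernstein j k x + (1 - 2 * real j * x) * (real k * Bernstein j k x) +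
        (real j * x)\<^sup>2 * Bernstein j k x)"
    by (intro sum.cong) (auto simp: algebra_simps power2_eq_square)
  also have "\<dots> = real j * (real j - 1) * x\<^sup>2 + (1 - 2 * real j * x) * (real j * x) + (real j * x)\<^sup>2"
    by (simp add: sum.distrib sum_distrib_left[symmetric])
  also have "\<dots> = real j * x * (1 - x)" by (simp add: algebra_simps power2_eq_square)
  finally show ?thesis .
qed

lemma Bernstein_Chebyshev:
  assumes "0 \<le> x" "x \<le> 1" "0 < d" "A \<subseteq> {..j}" "\<And>k. k \<in> A \<Longrightarrow> d \<le> \<bar>real k - real j * x\<bar>"
  shows "(\<Sum>k\<in>A. Bernstein j k x) \<le> real j * x * (1 - x) / d\<^sup>2"
proof -
  have "(\<Sum>k\<in>A. Bernstein j k x) \<le> (\<Sum>k\<in>A. (real k - real j * x)\<^sup>2 / d\<^sup>2 * Bernstein j k x)"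
  proof (rule sum_mono)
    fix k assume "k \<in> A"
    then have "d\<^sup>2 \<le> (real k - real j * x)\<^sup>2"
      using assms(3,5) by (metis abs_ge_zero abs_le_square_iff abs_of_pos)
    then have "1 \<le> (real k - real j * x)\<^sup>2 / d\<^sup>2" using assms(3) by simp
    then have "1 * Bernstein j k x \<le> (real k - real j * x)\<^sup>2 / d\<^sup>2 * Bernstein j k x"
      by (intro mult_right_mono Bernstein_nonneg assms(1,2))
    then show "Bernstein j k x \<le> (real k - real j * x)\<^sup>2 / d\<^sup>2 * Bernstein j k x" by simp
  qed
  also have "\<dots> \<le> (\<Sum>k\<le>j. (real k - real j * x)\<^sup>2 / d\<^sup>2 * Bernstein j k x)"
    by (intro sum_mono2 assms(4)) (auto intro!: divide_nonneg_nonneg mult_nonneg_nonneg Bernstein_nonneg assms(1,2))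
  also have "\<dots> = real j * x * (1 - x) / d\<^sup>2"
    by (simp add: Bernstein_variance[symmetric] sum_divide_distrib)
  finally show ?thesis .
qed

definition binomial_tail :: "nat \<Rightarrow> nat \<Rightarrow> real" where
  "binomial_tail j m = (\<Sum>k=m..j. Bernstein j k (2 / 3))"

lemma Bernstein_two_thirds: "k \<le> j \<Longrightarrow> Bernstein j k (2 / 3) = real (j choose k) * 2 ^ k / 3 ^ j"
  by (simp add: Bernstein_def power_divide power_diff field_simps)

lemma binomial_tail_nonneg: "0 \<le> binomial_tail j m"
  unfolding binomial_tail_def by (intro sum_nonneg Bernstein_nonneg) auto

lemma binomial_tail_complement: "binomial_tail j m = 1 - (\<Sum>k | k \<le> j \<and> k < m. Bernstein j k (2 / 3))"
proof -
  have "(\<Sum>k\<le>j. Bernstein j k (2 / 3)) = (\<Sum>k\<in>{m..j} \<union> {k. k \<le> j \<and> k < m}. Bernstein j k (2 / 3))"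
    by (rule sum.cong) auto
  also have "\<dots> = binomial_tail j m + (\<Sum>k | k \<le> j \<and> k < m. Bernstein j k (2 / 3))"
    unfolding binomial_tail_def by (rule sum.union_disjoint) auto
  finally show ?thesis by simp
qed

lemma binomial_tail_le_1: "binomial_tail j m \<le> 1"
  unfolding binomial_tail_complement by (auto intro!: sum_nonneg Bernstein_nonneg)

lemma binomial_tail_small:
  assumes "real j \<le> y" "0 < d" "2 * y / 3 + d \<le> real m"
  shows "binomial_tail j m \<le> 2 * y / (9 * d\<^sup>2)"
proof -
  have "binomial_tail j m \<le> real j * (2 / 3) * (1 - 2 / 3) / d\<^sup>2"
    unfolding binomial_tail_def using assms by (intro Bernstein_Chebyshev) auto
  also have "\<dots> = 2 * real j / (9 * d\<^sup>2)" by simp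
  also have "\<dots> \<le> 2 * y / (9 * d\<^sup>2)" using assms by (intro divide_right_mono) auto
  finally show ?thesis .
qed

text \<open>The bound must be uniform in \<open>j > y\<close>, although the variance grows with
  \<open>j\<close>; the gap from the mean to the values below \<open>m\<close> grows too.
  Quantifying over \<open>k < m\<close> lets the assumption hold vacuously at \<open>m = 0\<close>,
  even when \<open>2 * y / 3 - d\<close> is negative.\<close>

lemma binomial_tail_large:
  assumes "0 \<le> y" "y < real j" "0 < d" "\<And>k. k < m \<Longrightarrow> real k \<le> 2 * y / 3 - d"
  shows "1 - (2 * y / (9 * d\<^sup>2) + 1 / (12 * d)) \<le> binomial_tail j m"
proof -
  define h where "h = real j - y"
  define e where "e = 2 * h / 3 + d"
  have h: "0 < h" "real j = y + h" using assms by (auto simp: h_def)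
  have e: "0 < e" using h assms by (simp add: e_def)
  have "(\<Sum>k | k \<le> j \<and> k < m. Bernstein j k (2 / 3)) \<le> real j * (2 / 3) * (1 - 2 / 3) / e\<^sup>2"
  proof (rule Bernstein_Chebyshev)
    fix k assume "k \<in> {k. k \<le> j \<and> k < m}"
    then have "real k \<le> 2 * y / 3 - d" using assms(4) by blast
    then show "e \<le> \<bar>real k - real j * (2 / 3)\<bar>" unfolding e_def h_def using h(1) \<open>0 < d\<close>
      by (auto simp: h_def abs_if field_simps)
  qed (use e in auto)
  also have "\<dots> = 2 * y / (9 * e\<^sup>2) + 2 * h / (9 * e\<^sup>2)" unfolding h(2) by (simp add: algebra_simps add_divide_distrib[symmetric])
  also have "\<dots> \<le> 2 * y / (9 * d\<^sup>2) + 2 * h / (9 * (8 * h * d / 3))"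
  proof (intro add_mono divide_left_mono mult_left_mono)
    \<comment> \<open>AM-GM for the two summands of \<open>e\<close>: it absorbs the part of the
      variance due to the excess \<open>h\<close> and produces the term
      \<open>1 / (12 * d)\<close>.\<close>
    have "0 \<le> (2 * h / 3 - d)\<^sup>2" by simp
    then show "8 * h * d / 3 \<le> e\<^sup>2" by (simp add: e_def power2_eq_square algebra_simps)
    show "d\<^sup>2 \<le> e\<^sup>2" using assms h by (intro power_mono) (auto simp: e_def)
  qed (use assms h e in auto)
  also have "2 * h / (9 * (8 * h * d / 3)) = 1 / (12 * d)" using h assms by simp
  finally show ?thesis unfolding binomial_tail_complement by simp
qed

subsection \<open>From marks to fixed points\<close>

text \<open>Conditioning the number of marks on the permutation: 3^j times the binomial probability
  of \<open>k\<close> is (j choose k) 2^k, the total weight of choosing \<open>k\<close> marks among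
  \<open>j\<close> fixed points.\<close>

lemma weighted_binomial_tail:
  assumes "\<tau> \<in> {[1,3,2], [3,2,1], [2,1,3]}"
  shows "(\<Sum>\<sigma>\<in>avoiders n \<tau>. 3 ^ fixpoints n \<sigma> / partition_fn 3 n \<tau> * binomial_tail (fixpoints n \<sigma>) m) = mark_tail n m"
proof -
  have "3 ^ fixpoints n \<sigma> * binomial_tail (fixpoints n \<sigma>) m = (\<Sum>k=m..n. real (fixpoints n \<sigma> choose k) * 2 ^ k)" for \<sigma>
  proof -
    have "3 ^ fixpoints n \<sigma> * binomial_tail (fixpoints n \<sigma>) m = (\<Sum>k=m..fixpoints n \<sigma>. real (fixpoints n \<sigma> choose k) * 2 ^ k)"
      unfolding binomial_tail_def sum_distrib_left by (intro sum.cong) (auto simp: Bernstein_two_thirds)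
    also have "\<dots> = (\<Sum>k=m..n. real (fixpoints n \<sigma> choose k) * 2 ^ k)"
      by (rule sum.mono_neutral_left) (use fixpoints_le[of n \<sigma>] in auto)
    finally show ?thesis .
  qed
  then have "(\<Sum>\<sigma>\<in>avoiders n \<tau>. 3 ^ fixpoints n \<sigma> / partition_fn 3 n \<tau> * binomial_tail (fixpoints n \<sigma>) m) =
      (\<Sum>\<sigma>\<in>avoiders n \<tau>. \<Sum>k=m..n. real (fixpoints n \<sigma> choose k) * 2 ^ k) / partition_fn 3 n \<tau>"
    by (simp add: sum_divide_distrib)
  also have "(\<Sum>\<sigma>\<in>avoiders n \<tau>. \<Sum>k=m..n. real (fixpoints n \<sigma> choose k) * 2 ^ k) =
      (\<Sum>k=m..n. (\<Sum>\<sigma>\<in>avoiders n \<tau>. real (fixpoints n \<sigma> choose k)) * 2 ^ k)"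
    by (subst sum.swap) (simp add: sum_distrib_right)
  also have "\<dots> = (\<Sum>k=m..n. ballot n k * 2 ^ k)"
    using sum_choose_fixpoints[OF assms] by (intro sum.cong) auto
  finally show ?thesis
    using partition_fn_eq[OF assms, of 2 n] by (simp add: mark_tail_def)
qed

lemma id_mem_avoiders:
  assumes "\<tau> \<in> {[1,3,2], [3,2,1], [2,1,3]}"
  shows "id \<in> avoiders n \<tau>"
  using assms by (auto simp: avoiders_def contains_pattern_triple permutes_id)

lemma partition_fn_pos:
  assumes "\<tau> \<in> {[1,3,2], [3,2,1], [2,1,3]}" "0 < q"
  shows "0 < partition_fn q n \<tau>"
  unfolding partition_fn_def
  by (rule sum_pos) (use id_mem_avoiders[OF assms(1)] assms(2) in auto)

definition fp_tail :: "nat \<Rightarrow> nat list \<Rightarrow> real \<Rightarrow> real" where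
  "fp_tail n \<tau> y = (\<Sum>\<sigma> | \<sigma> \<in> avoiders n \<tau> \<and> y < real (fixpoints n \<sigma>). 3 ^ fixpoints n \<sigma> / partition_fn 3 n \<tau>)"

text \<open>More than \<open>y\<close> fixed points force at least \<open>m\<close> marks, up to the
  error of \<open>binomial_tail_large\<close>; averaging over avoiders keeps the error because the
  weights sum to 1.\<close>

lemma fp_tail_upper:
  assumes "\<tau> \<in> {[1,3,2], [3,2,1], [2,1,3]}" "0 \<le> y" "0 < d" "\<And>k. k < m \<Longrightarrow> real k \<le> 2 * y / 3 - d"
  shows "fp_tail n \<tau> y \<le> mark_tail n m + (2 * y / (9 * d\<^sup>2) + 1 / (12 * d))"
proof -
  define w where "w \<sigma> = 3 ^ fixpoints n \<sigma> / partition_fn 3 n \<tau>" for \<sigma>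
  define e where "e = 2 * y / (9 * d\<^sup>2) + 1 / (12 * d)"
  let ?B = "{\<sigma>. \<sigma> \<in> avoiders n \<tau> \<and> y < real (fixpoints n \<sigma>)}"
  have w: "0 \<le> w \<sigma>" for \<sigma>
    using partition_fn_pos[OF assms(1), of 3 n] by (simp add: w_def)
  have e: "0 \<le> e" using assms by (simp add: e_def)
  have "fp_tail n \<tau> y \<le> (\<Sum>\<sigma>\<in>?B. w \<sigma> * binomial_tail (fixpoints n \<sigma>) m + w \<sigma> * e)"
    unfolding fp_tail_def w_def[symmetric]
  proof (rule sum_mono)
    fix \<sigma> assume "\<sigma> \<in> ?B"
    then have "1 \<le> binomial_tail (fixpoints n \<sigma>) m + e"
      using binomial_tail_large[OF assms(2) _ assms(3,4), of "fixpoints n \<sigma>" m] unfolding e_def by simp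
    then have "w \<sigma> * 1 \<le> w \<sigma> * (binomial_tail (fixpoints n \<sigma>) m + e)"
      using w by (rule mult_left_mono)
    then show "w \<sigma> \<le> w \<sigma> * binomial_tail (fixpoints n \<sigma>) m + w \<sigma> * e" by (simp add: distrib_left)
  qed
  also have "\<dots> \<le> (\<Sum>\<sigma>\<in>avoiders n \<tau>. w \<sigma> * binomial_tail (fixpoints n \<sigma>) m + w \<sigma> * e)"
    using w e by (intro sum_mono2) (auto intro!: add_nonneg_nonneg mult_nonneg_nonneg binomial_tail_nonneg)
  also have "\<dots> = mark_tail n m + (\<Sum>\<sigma>\<in>avoiders n \<tau>. w \<sigma>) * e"
    using weighted_binomial_tail[OF assms(1)] by (simp add: w_def sum.distrib sum_distrib_right)
  also have "(\<Sum>\<sigma>\<in>avoiders n \<tau>. w \<sigma>) = 1"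
    using partition_fn_pos[OF assms(1), of 3 n]
    by (simp add: w_def sum_divide_distrib[symmetric] partition_fn_def)
  finally show ?thesis by (simp add: e_def)
qed

text \<open>The converse comparison: at most \<open>y\<close> fixed points rarely carry
  \<open>m\<close> marks.\<close>

lemma fp_tail_lower:
  assumes "\<tau> \<in> {[1,3,2], [3,2,1], [2,1,3]}" "0 \<le> y" "0 < d" "2 * y / 3 + d \<le> real m"
  shows "mark_tail n m - 2 * y / (9 * d\<^sup>2) \<le> fp_tail n \<tau> y"
proof -
  define w where "w \<sigma> = 3 ^ fixpoints n \<sigma> / partition_fn 3 n \<tau>" for \<sigma>
  define e where "e = 2 * y / (9 * d\<^sup>2)"
  have w: "0 \<le> w \<sigma>" for \<sigma>
    using partition_fn_pos[OF assms(1), of 3 n] by (simp add: w_def)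
  have e: "0 \<le> e" using assms by (simp add: e_def)
  have "mark_tail n m = (\<Sum>\<sigma>\<in>avoiders n \<tau>. w \<sigma> * binomial_tail (fixpoints n \<sigma>) m)"
    unfolding w_def weighted_binomial_tail[OF assms(1)] ..
  also have "\<dots> \<le> (\<Sum>\<sigma>\<in>avoiders n \<tau>. w \<sigma> * of_bool (y < real (fixpoints n \<sigma>)) + w \<sigma> * e)"
    unfolding distrib_left[symmetric]
  proof (intro sum_mono mult_left_mono w)
    fix \<sigma>
    show "binomial_tail (fixpoints n \<sigma>) m \<le> of_bool (y < real (fixpoints n \<sigma>)) + e"
      using binomial_tail_small[OF _ assms(3,4), of "fixpoints n \<sigma>"] binomial_tail_le_1[of "fixpoints n \<sigma>" m] e
      by (cases "y < real (fixpoints n \<sigma>)") (auto simp: e_def)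
  qed
  also have "\<dots> = (\<Sum>\<sigma>\<in>avoiders n \<tau>. w \<sigma> * of_bool (y < real (fixpoints n \<sigma>))) + (\<Sum>\<sigma>\<in>avoiders n \<tau>. w \<sigma>) * e"
    by (simp add: sum.distrib sum_distrib_right)
  also have "(\<Sum>\<sigma>\<in>avoiders n \<tau>. w \<sigma>) = 1"
    using partition_fn_pos[OF assms(1), of 3 n]
    by (simp add: w_def sum_divide_distrib[symmetric] partition_fn_def)
  also have "(\<Sum>\<sigma>\<in>avoiders n \<tau>. w \<sigma> * of_bool (y < real (fixpoints n \<sigma>))) = fp_tail n \<tau> y"
    unfolding fp_tail_def w_def[symmetric] by (rule sum.mono_neutral_cong_right) auto
  finally show ?thesis by (simp add: e_def)
qed

lemma fp_tail_tendsto: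
  assumes \<tau>: "\<tau> \<in> {[1,3,2], [3,2,1], [2,1,3]}" and x: "0 \<le> x"
  shows "(\<lambda>n. fp_tail n \<tau> (x * sqrt (real n))) \<longlonglongrightarrow> exp (- x\<^sup>2 / 9)"
proof (rule tendsto_sandwich)
  define y where "y n = x * sqrt (real n)" for n
  \<comment> \<open>The window must be negligible against sqrt n, while its square dominates the
    variance, which is of order sqrt n. Any exponent strictly between 1/4 and 1/2 would do.\<close>
  define d where "d n = real n powr (3 / 8)" for n
  \<comment> \<open>\<open>nat\<close> truncates to 0 when the window reaches below 0, as it does
    for \<open>x = 0\<close>.\<close>
  define lo where "lo n = nat \<lceil>2 * y n / 3 - d n\<rceil>" for n
  define hi where "hi n = nat \<lceil>2 * y n / 3 + d n\<rceil>" for n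
  have y: "0 \<le> y n" for n using x by (simp add: y_def)
  have small: "(\<lambda>n. d n / sqrt (real n)) \<longlonglongrightarrow> 0" "(\<lambda>n. 1 / sqrt (real n)) \<longlonglongrightarrow> 0"
    unfolding d_def by real_asymp+
  have lim: "(\<lambda>n. real (lo n) / sqrt (real n)) \<longlonglongrightarrow> 2 * x / 3" "(\<lambda>n. real (hi n) / sqrt (real n)) \<longlonglongrightarrow> 2 * x / 3"
  proof -
    have bound: "(\<lambda>n. real (a n) / sqrt (real n)) \<longlonglongrightarrow> 2 * x / 3"
      if a: "\<And>n. 2 * y n / 3 - d n \<le> real (a n)" "\<And>n. real (a n) \<le> 2 * y n / 3 + d n + 1" for a :: "nat \<Rightarrow> nat"
    proof (rule tendsto_sandwich)
      have div: "(2 * y n / 3 + c) / sqrt (real n) = 2 * x / 3 + c / sqrt (real n)" if "0 < n" for n c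
        using that by (simp add: y_def field_simps)
      show "\<forall>\<^sub>F n in sequentially. 2 * x / 3 - d n / sqrt (real n) \<le> real (a n) / sqrt (real n)"
        using eventually_gt_at_top[of 0]
      proof eventually_elim
        case (elim n)
        have "(2 * y n / 3 + (- d n)) / sqrt (real n) \<le> real (a n) / sqrt (real n)"
          using a(1)[of n] by (intro divide_right_mono) auto
        then show ?case unfolding div[OF elim] by simp
      qed
      show "\<forall>\<^sub>F n in sequentially. real (a n) / sqrt (real n) \<le> 2 * x / 3 + (d n / sqrt (real n) + 1 / sqrt (real n))"
        using eventually_gt_at_top[of 0]
      proof eventually_elim
        case (elim n)
        have "real (a n) / sqrt (real n) \<le> (2 * y n / 3 + (d n + 1)) / sqrt (real n)"
          using a(2)[of n] by (intro divide_right_mono) auto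
        then show ?case unfolding div[OF elim] by (simp add: add_divide_distrib)
      qed
      show "(\<lambda>n. 2 * x / 3 - d n / sqrt (real n)) \<longlonglongrightarrow> 2 * x / 3"
        using tendsto_diff[OF tendsto_const small(1)] by simp
      show "(\<lambda>n. 2 * x / 3 + (d n / sqrt (real n) + 1 / sqrt (real n))) \<longlonglongrightarrow> 2 * x / 3"
        using tendsto_add[OF tendsto_const tendsto_add[OF small]] by simp
    qed
    have d: "0 \<le> d n" for n by (simp add: d_def)
    show "(\<lambda>n. real (lo n) / sqrt (real n)) \<longlonglongrightarrow> 2 * x / 3"
    proof (rule bound)
      fix n
      show "2 * y n / 3 - d n \<le> real (lo n)" unfolding lo_def by linarith
      have "real (lo n) \<le> max 0 (2 * y n / 3 - d n + 1)" unfolding lo_def by linarith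
      then show "real (lo n) \<le> 2 * y n / 3 + d n + 1" using y[of n] d[of n] by linarith
    qed
    show "(\<lambda>n. real (hi n) / sqrt (real n)) \<longlonglongrightarrow> 2 * x / 3"
    proof (rule bound)
      fix n
      show "2 * y n / 3 - d n \<le> real (hi n)" unfolding hi_def using d[of n] by linarith
      have "real (hi n) \<le> max 0 (2 * y n / 3 + d n + 1)" unfolding hi_def by linarith
      then show "real (hi n) \<le> 2 * y n / 3 + d n + 1" using y[of n] d[of n] by linarith
    qed
  qed
  \<comment> \<open>Two thirds of the fixed points are marked on average, hence
    \<open>c = 2 * x / 3\<close> in the limit law of the marks.\<close>
  have exp_eq: "exp (- (2 * x / 3)\<^sup>2 / 4) = exp (- x\<^sup>2 / 9)"
    by (simp add: power2_eq_square)
  have "(\<lambda>n. (2 * x / 9) * (sqrt (real n) / (d n)\<^sup>2)) \<longlonglongrightarrow> (2 * x / 9) * 0"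
    by (rule tendsto_mult_left) (unfold d_def, real_asymp)
  then have err1: "(\<lambda>n. 2 * y n / (9 * (d n)\<^sup>2)) \<longlonglongrightarrow> 0" by (simp add: y_def mult.assoc)
  have err2: "(\<lambda>n. 1 / (12 * d n)) \<longlonglongrightarrow> 0" unfolding d_def by real_asymp
  show "\<forall>\<^sub>F n in sequentially. mark_tail n (hi n) - 2 * y n / (9 * (d n)\<^sup>2) \<le> fp_tail n \<tau> (x * sqrt (real n))"
    using eventually_gt_at_top[of 0]
  proof eventually_elim
    case (elim n)
    show ?case unfolding y_def[symmetric]
      by (rule fp_tail_lower[OF \<tau> y]) (use elim in \<open>auto simp: d_def hi_def intro: real_nat_ceiling_ge\<close>)
  qed
  show "\<forall>\<^sub>F n in sequentially. fp_tail n \<tau> (x * sqrt (real n)) \<le> mark_tail n (lo n) + (2 * y n / (9 * (d n)\<^sup>2) + 1 / (12 * d n))"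
    using eventually_gt_at_top[of 0]
  proof eventually_elim
    case (elim n)
    show ?case unfolding y_def[symmetric]
    proof (rule fp_tail_upper[OF \<tau> y])
      show "0 < d n" using elim by (simp add: d_def)
      fix k assume "k < lo n"
      then show "real k \<le> 2 * y n / 3 - d n" unfolding lo_def by linarith
    qed
  qed
  show "(\<lambda>n. mark_tail n (hi n) - 2 * y n / (9 * (d n)\<^sup>2)) \<longlonglongrightarrow> exp (- x\<^sup>2 / 9)"
    using tendsto_diff[OF mark_tail_tendsto[OF lim(2)] err1] unfolding exp_eq by simp
  show "(\<lambda>n. mark_tail n (lo n) + (2 * y n / (9 * (d n)\<^sup>2) + 1 / (12 * d n))) \<longlonglongrightarrow> exp (- x\<^sup>2 / 9)"
    using tendsto_add[OF mark_tail_tendsto[OF lim(1)] tendsto_add[OF err1 err2]] unfolding exp_eq by simp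
qed

section \<open>Distribution functions and weak convergence\<close>

lemma cdf_rayleigh:
  assumes "0 < s"
  shows "cdf (rayleigh s) x = (if x < 0 then 0 else 1 - exp (- x\<^sup>2 / (2 * s\<^sup>2)))"
proof -
  have meas: "(\<lambda>x. ennreal (rayleigh_density s x)) \<in> borel_measurable lborel"
    unfolding rayleigh_density_def by measurable
  have em: "emeasure (rayleigh s) {..x} = (\<integral>\<^sup>+t. ennreal (rayleigh_density s t) * indicator {..x} t \<partial>lborel)"
    unfolding rayleigh_def by (rule emeasure_density[OF meas]) simp
  show ?thesis
  proof (cases "x < 0")
    case True
    have zero: "ennreal (rayleigh_density s t) * indicator {..x} t = 0" for t
      using True by (auto simp: rayleigh_density_def indicator_def)
    have "emeasure (rayleigh s) {..x} = 0" unfolding em zero by simp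
    then show ?thesis using True by (simp add: cdf_def measure_def)
  next
    case False
    let ?f = "\<lambda>t. t / s\<^sup>2 * exp (- t\<^sup>2 / (2 * s\<^sup>2))"
    let ?F = "\<lambda>t. - exp (- t\<^sup>2 / (2 * s\<^sup>2))"
    have "emeasure (rayleigh s) {..x} = (\<integral>\<^sup>+t. ennreal (?f t) * indicator {0..x} t \<partial>lborel)"
      unfolding em by (intro nn_integral_cong) (auto simp: rayleigh_density_def indicator_def)
    also have "\<dots> = ennreal (?F x - ?F 0)"
    proof (rule nn_integral_FTC_Icc)
      fix t assume t: "t \<in> {0..x}"
      show "(?F has_real_derivative ?f t) (at t)"
        using assms by (auto intro!: derivative_eq_intros simp: field_simps)
      show "0 \<le> ?f t" using t by simp
    qed (use False in auto)
    finally show ?thesis using False assms by (simp add: cdf_def measure_def)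
  qed
qed

text \<open>Positive \<open>n\<close> allows clearing the denominator \<open>sqrt n\<close>; the
  density vanishes off the finite set of avoiders, so the measure is a finite sum.\<close>

lemma cdf_scaled_fp_law:
  assumes "\<tau> \<in> {[1,3,2], [3,2,1], [2,1,3]}" "0 < n"
  shows "cdf (scaled_fp_law 3 n \<tau>) x = 1 - fp_tail n \<tau> (x * sqrt (real n))"
proof -
  define w where "w \<sigma> = 3 ^ fixpoints n \<sigma> / partition_fn 3 n \<tau>" for \<sigma>
  let ?A = "avoiders n \<tau>"
  let ?S = "{\<sigma>. real (fixpoints n \<sigma>) \<le> x * sqrt (real n)}"
  have w: "0 \<le> w \<sigma>" for \<sigma>
    using partition_fn_pos[OF assms(1), of 3 n] by (simp add: w_def)
  have "cdf (scaled_fp_law 3 n \<tau>) x = measure (weighted_perm_measure 3 n \<tau>) ?S"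
    unfolding cdf_def scaled_fp_law_def
    by (subst measure_distr)
       (use assms(2) in \<open>auto simp: weighted_perm_measure_def vimage_def divide_le_eq measurable_def\<close>)
  also have "\<dots> = (\<Sum>\<sigma>\<in>?A \<inter> ?S. w \<sigma>)"
  proof -
    have "emeasure (weighted_perm_measure 3 n \<tau>) ?S =
        (\<integral>\<^sup>+\<sigma>. ennreal (if \<sigma> \<in> ?A then w \<sigma> else 0) * indicator ?S \<sigma> \<partial>count_space UNIV)"
      unfolding weighted_perm_measure_def w_def by (rule emeasure_density) auto
    also have "\<dots> = (\<Sum>\<sigma>\<in>?A \<inter> ?S. ennreal (if \<sigma> \<in> ?A then w \<sigma> else 0) * indicator ?S \<sigma>)"
      by (rule nn_integral_count_space') (auto simp: indicator_def)
    also have "\<dots> = (\<Sum>\<sigma>\<in>?A \<inter> ?S. ennreal (w \<sigma>))" by (rule sum.cong) auto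
    also have "\<dots> = ennreal (\<Sum>\<sigma>\<in>?A \<inter> ?S. w \<sigma>)" using w by (intro sum_ennreal) auto
    finally show ?thesis using w by (simp add: measure_def sum_nonneg)
  qed
  also have "\<dots> = 1 - fp_tail n \<tau> (x * sqrt (real n))"
  proof -
    have "(\<Sum>\<sigma>\<in>?A \<inter> ?S. w \<sigma>) + fp_tail n \<tau> (x * sqrt (real n)) = (\<Sum>\<sigma>\<in>?A. w \<sigma>)"
      unfolding fp_tail_def w_def[symmetric]
      by (subst sum.union_disjoint[symmetric]) (auto intro!: sum.cong)
    also have "\<dots> = 1"
      using partition_fn_pos[OF assms(1), of 3 n]
      by (simp add: w_def sum_divide_distrib[symmetric] partition_fn_def)
    finally show ?thesis by simp
  qed
  finally show ?thesis .
qed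

theorem theorem4:
  assumes "\<tau> \<in> {[1,3,2], [3,2,1], [2,1,3]}"
  shows "weak_conv_m (\<lambda>n. scaled_fp_law 3 n \<tau>) (rayleigh (3 / sqrt 2))"
  unfolding weak_conv_m_def weak_conv_def
proof (intro allI impI)
  fix x
  \<comment> \<open>Here 2 s^2 = 9. The limit is established at every \<open>x\<close>, which covers
    all continuity points.\<close>
  have ray: "cdf (rayleigh (3 / sqrt 2)) x = (if x < 0 then 0 else 1 - exp (- x\<^sup>2 / 9))"
    by (simp add: cdf_rayleigh power_divide)
  have "(\<lambda>n. 1 - fp_tail n \<tau> (x * sqrt (real n))) \<longlonglongrightarrow> cdf (rayleigh (3 / sqrt 2)) x"
  proof (cases "x < 0")
    case True
    \<comment> \<open>A negative threshold is exceeded by every avoider, so the tail is the total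
      mass.\<close>
    have "\<forall>\<^sub>F n in sequentially. 1 - fp_tail n \<tau> (x * sqrt (real n)) = 0"
      using eventually_gt_at_top[of 0]
    proof eventually_elim
      case (elim n)
      have "x * sqrt (real n) < 0" using True elim by (simp add: mult_neg_pos)
      then have "x * sqrt (real n) < real (fixpoints n \<sigma>)" for \<sigma> by (rule less_le_trans) simp
      then have "fp_tail n \<tau> (x * sqrt (real n)) = 1"
        using partition_fn_pos[OF assms, of 3 n]
        by (simp add: fp_tail_def sum_divide_distrib[symmetric] partition_fn_def)
      then show ?case by simp
    qed
    then show ?thesis using True ray by (simp add: tendsto_eventually)
  next
    case False
    then show ?thesis using tendsto_diff[OF tendsto_const fp_tail_tendsto[OF assms, of x]] by (simp add: ray)
  qed
  then show "(\<lambda>n. cdf (scaled_fp_law 3 n \<tau>) x) \<longlonglongrightarrow> cdf (rayleigh (3 / sqrt 2)) x"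
    by (rule Lim_transform_eventually)
       (use eventually_gt_at_top[of 0] in eventually_elim, simp add: cdf_scaled_fp_law[OF assms])
qed

end
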